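(* Let $0<\varepsilon\le1$, let $\beta<\beta_c(\varepsilon)$ and let $c_n$ be an intermediate time-scale with parameter $\varepsilon$. Then, $\mathbb P$-almost surely, for all $t,s>0$, $$\lim_{n\to\infty}\mathcal C_n(t,s)=0.$$
   Context: For $n\ge 1$ let $\mathcal V_n=\{-1,1\}^n$ be the discrete cube, with edges between vertices that differ in exactly one coordinate. Let $(\mathcal H_n(x))_{x\in\mathcal V_n}$ be independent centered Gaussian random variables of variance $n$ (for all $n$ defined on a common probability space with law $\mathbb P$, called the random environment). For $\beta>0$ set $\tau_n(x)=\exp\{-\beta\mathcal H_n(x)\}$. Given the environment, $(X_n(t))_{t>0}$ is the Markov jump process on $\mathcal V_n$ with rates $\lambda_n(x,y)=1/(n\tau_n(x))$ if $(x,y)$ is an edge and $0$ otherwise, started from the uniform distribution $\pi_n(x)=2^{-n}$; $\mathcal P_{\pi_n}$ denotes its law for a fixed realization of the environment. Given a diverging sequence $c_n$ (time-scale), $a_n$ is defined by $a_n\mathbb P(\tau_n(x)\ge c_n)=1$. $c_n$ is an intermediate time-scale (with parameter $0<\varepsilon\le1$) if $\lim_n\frac{\log a_n}{n\log 2}=\varepsilon$ and $\lim_n a_n/2^n=0$. Set $\beta_c(\varepsilon)=\sqrt{2\varepsilon\log2}$. With $(\cdot,\cdot)$ the inner product in $\mathbb R^n$, $\mathcal C_n(t,s)=\mathcal P_{\pi_n}\big(n^{-1}(X_n(c_nt),X_n(c_nu))=1\ \forall\, t\le u<t+s\big)$. *)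

theory Defs
  imports "HOL-Probability.Probability"
begin

section \<open>The discrete cube\<close>

definition cube :: "nat \<Rightarrow> (nat \<Rightarrow> real) set" where
  "cube n = {..<n} \<rightarrow>\<^sub>E {-1, 1}"

definition cube_edge :: "nat \<Rightarrow> (nat \<Rightarrow> real) \<Rightarrow> (nat \<Rightarrow> real) \<Rightarrow> bool" where
  "cube_edge n x y \<longleftrightarrow> x \<in> cube n \<and> y \<in> cube n \<and> card {i \<in> {..<n}. x i \<noteq> y i} = 1"

definition inner_prod :: "nat \<Rightarrow> (nat \<Rightarrow> real) \<Rightarrow> (nat \<Rightarrow> real) \<Rightarrow> real" where
  "inner_prod n x y = (\<Sum>i<n. x i * y i)"


section \<open>Markov jump processes on a finite state space\<close>

text \<open>
  A function r gives the jump rates r x y from x to y; its diagonal is ignored.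
  The transition function is the matrix exponential of t times the generator.
\<close>

definition generator :: "'a set \<Rightarrow> ('a \<Rightarrow> 'a \<Rightarrow> real) \<Rightarrow> 'a \<Rightarrow> 'a \<Rightarrow> real" where
  "generator S r x y = (if x = y then - (\<Sum>z\<in>S - {x}. r x z) else r x y)"

primrec generator_pow :: "'a set \<Rightarrow> ('a \<Rightarrow> 'a \<Rightarrow> real) \<Rightarrow> nat \<Rightarrow> 'a \<Rightarrow> 'a \<Rightarrow> real" where
  "generator_pow S r 0 x y = (if x = y then 1 else 0)"
| "generator_pow S r (Suc k) x y = (\<Sum>z\<in>S. generator S r x z * generator_pow S r k z y)"

definition transition :: "'a set \<Rightarrow> ('a \<Rightarrow> 'a \<Rightarrow> real) \<Rightarrow> real \<Rightarrow> 'a \<Rightarrow> 'a \<Rightarrow> real" where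
  "transition S r t x y = (\<Sum>k. t ^ k / fact k * generator_pow S r k x y)"

text \<open>
  X is a realization, on the probability space N and with time set the nonnegative reals, of
  the Markov jump process on S with rates r and initial law mu. Every path is a right-continuous
  step function with left limits (for the discrete topology of S), so it makes finitely many jumps
  in bounded time. This makes events constraining the path over a whole time interval
  measurable, with probabilities determined by the finite-dimensional distributions.
\<close>

definition markov_jump_process ::
    "'b measure \<Rightarrow> (real \<Rightarrow> 'b \<Rightarrow> 'a) \<Rightarrow> 'a set \<Rightarrow> ('a \<Rightarrow> 'a \<Rightarrow> real) \<Rightarrow> ('a \<Rightarrow> real) \<Rightarrow> bool" where
  "markov_jump_process N X S r \<mu> \<longleftrightarrow>
     prob_space N \<and>
     (\<forall>t\<ge>0. X t \<in> measurable N (count_space S)) \<and>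
     (\<forall>w\<in>space N. \<forall>t\<ge>0. \<forall>\<^sub>F u in at_right t. X u w = X t w) \<and>
     (\<forall>w\<in>space N. \<forall>t>0. \<exists>z\<in>S. \<forall>\<^sub>F u in at_left t. X u w = z) \<and>
     (\<forall>(k::nat) (t :: nat \<Rightarrow> real) (x :: nat \<Rightarrow> 'a).
        t 0 = 0 \<longrightarrow> (\<forall>i<k. t i < t (Suc i)) \<longrightarrow> (\<forall>i\<le>k. x i \<in> S) \<longrightarrow>
        measure N {w \<in> space N. \<forall>i\<le>k. X (t i) w = x i} =
          \<mu> (x 0) * (\<Prod>i<k. transition S r (t (Suc i) - t i) (x i) (x (Suc i))))"


section \<open>Random environment and random hopping time dynamics\<close>

text \<open>
  No assumption is made on the joint law of the environments for different n.
\<close>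

definition rem_environment :: "'w measure \<Rightarrow> (nat \<Rightarrow> (nat \<Rightarrow> real) \<Rightarrow> 'w \<Rightarrow> real) \<Rightarrow> bool" where
  "rem_environment M H \<longleftrightarrow>
     prob_space M \<and>
     (\<forall>n\<ge>1. prob_space.indep_vars M (\<lambda>_. borel) (H n) (cube n) \<and>
            (\<forall>x\<in>cube n. distributed M lborel (H n x) (normal_density 0 (sqrt (real n)))))"

definition tau :: "real \<Rightarrow> (nat \<Rightarrow> (nat \<Rightarrow> real) \<Rightarrow> 'w \<Rightarrow> real) \<Rightarrow> nat \<Rightarrow> (nat \<Rightarrow> real) \<Rightarrow> 'w \<Rightarrow> real" where
  "tau \<beta> H n x \<omega> = exp (- \<beta> * H n x \<omega>)"

definition jump_rate ::
    "real \<Rightarrow> (nat \<Rightarrow> (nat \<Rightarrow> real) \<Rightarrow> 'w \<Rightarrow> real) \<Rightarrow> nat \<Rightarrow> 'w \<Rightarrow> (nat \<Rightarrow> real) \<Rightarrow> (nat \<Rightarrow> real) \<Rightarrow> real" where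
  "jump_rate \<beta> H n \<omega> x y = (if cube_edge n x y then 1 / (real n * tau \<beta> H n x \<omega>) else 0)"

definition intermediate_time_scale ::
    "'w measure \<Rightarrow> (nat \<Rightarrow> (nat \<Rightarrow> real) \<Rightarrow> 'w \<Rightarrow> real) \<Rightarrow> real \<Rightarrow> real \<Rightarrow> (nat \<Rightarrow> real) \<Rightarrow> (nat \<Rightarrow> real) \<Rightarrow> bool" where
  "intermediate_time_scale M H \<beta> \<epsilon> c a \<longleftrightarrow>
     filterlim c at_top sequentially \<and>
     (\<forall>n\<ge>1. \<forall>x\<in>cube n. a n * measure M {\<omega> \<in> space M. tau \<beta> H n x \<omega> \<ge> c n} = 1) \<and>
     (\<lambda>n. ln (a n) / (real n * ln 2)) \<longlonglongrightarrow> \<epsilon> \<and>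
     (\<lambda>n. a n / 2 ^ n) \<longlonglongrightarrow> 0"

definition beta_c :: "real \<Rightarrow> real" where
  "beta_c \<epsilon> = sqrt (2 * \<epsilon> * ln 2)"

definition correlation ::
    "'b measure \<Rightarrow> (real \<Rightarrow> 'b \<Rightarrow> nat \<Rightarrow> real) \<Rightarrow> nat \<Rightarrow> real \<Rightarrow> real \<Rightarrow> real \<Rightarrow> real" where
  "correlation N X n c t s =
     measure N {w \<in> space N. \<forall>u. t \<le> u \<and> u < t + s \<longrightarrow>
       inner_prod n (X (c * t) w) (X (c * u) w) / real n = 1}"

end

theory Submission
  imports Defs "HOL-Real_Asymp.Real_Asymp"
begin

text \<open>
  Only the holding rate \<open>1 / \<tau>(x)\<close> of the current vertex matters for the correlation, so it
  suffices to show that at time \<open>T = c\<^sub>n t\<close> the process is unlikely to sit in the set \<open>A\<close> of traps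
  with \<open>\<tau> \<ge> c\<^sub>n / n\<close>. This is a Lyapunov estimate: if \<open>\<phi> \<ge> 1\<^sub>A\<close> satisfies
  \<open>Q \<phi> \<le> \<phi> / T\<close> for the generator \<open>Q\<close>, then this probability is at most \<open>e\<close> times the
  uniform mean of \<open>\<phi>\<close>. Since \<open>Q = \<tau>\<^sup>-\<^sup>1 (P - 1)\<close> with \<open>P\<close> the simple random walk on the cube,
  one may take for \<open>\<phi>\<close> the solution of \<open>(1 + V - P) \<phi> = 2 1\<^sub>A\<close> with \<open>V = min \<tau> L / T\<close>.
  Its mean is estimated by the energy identity and the Poincare inequality of the cube, in terms
  of the fractions of vertices with \<open>\<tau> \<ge> c\<^sub>n / n\<close> and with \<open>\<tau> \<ge> L\<close>. These are controlled almost
  surely by the first and second moment method. The choice \<open>L = exp (\<beta>\<^sup>2 n)\<close>, the level that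
  dominates the mean of \<open>\<tau>\<close>, leaves the exponential rates \<open>- (\<beta>\<^sub>c - \<beta>)\<^sup>2 / 2\<close> and
  \<open>(\<beta>\<^sup>2 - \<beta>\<^sub>c\<^sup>2) / 2\<close>, both negative for \<open>\<beta> < \<beta>\<^sub>c\<close>.
\<close>

section \<open>Jump processes: Lyapunov functions and holding times\<close>

lemma generator_pow_bound:
  assumes "finite S" "x \<in> S"
  shows "\<bar>generator_pow S r k x y\<bar> \<le> (\<Sum>x\<in>S. \<Sum>z\<in>S. \<bar>generator S r x z\<bar>) ^ k"
  using assms(2)
proof (induction k arbitrary: x)
  case 0
  then show ?case by simp
next
  case (Suc k)
  let ?B = "\<Sum>x\<in>S. \<Sum>z\<in>S. \<bar>generator S r x z\<bar>"
  have B: "?B \<ge> 0" by (intro sum_nonneg) auto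
  have "\<bar>generator_pow S r (Suc k) x y\<bar> \<le> (\<Sum>z\<in>S. \<bar>generator S r x z\<bar> * \<bar>generator_pow S r k z y\<bar>)"
    by (simp flip: abs_mult)
  also have "\<dots> \<le> (\<Sum>z\<in>S. \<bar>generator S r x z\<bar> * ?B ^ k)"
    by (intro sum_mono mult_left_mono Suc.IH) auto
  also have "\<dots> = (\<Sum>z\<in>S. \<bar>generator S r x z\<bar>) * ?B ^ k"
    by (simp add: sum_distrib_right)
  \<comment> \<open>The sum of all absolute entries dominates every row sum; so crude a constant
    suffices because the exponential series converges everywhere.\<close>
  also have "\<dots> \<le> ?B * ?B ^ k"
    using assms(1) Suc.prems B
    by (intro mult_right_mono member_le_sum[of x S "\<lambda>x. \<Sum>z\<in>S. \<bar>generator S r x z\<bar>"])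
       (auto intro: sum_nonneg)
  finally show ?case by simp
qed

text \<open>\<open>generator_pow\<close> adds factors on the left; by associativity they may be
  added on the right, as the forward equation requires.\<close>

lemma generator_pow_Suc_right:
  assumes "finite S" "x \<in> S" "y \<in> S"
  shows "generator_pow S r (Suc k) x y = (\<Sum>z\<in>S. generator_pow S r k x z * generator S r z y)"
  using assms(2)
proof (induction k arbitrary: x)
  case 0
  have "generator S r x z * (if z = y then 1 else 0) = (if z = y then generator S r x z else 0)"
    "(if x = z then 1 else 0) * generator S r z y = (if x = z then generator S r z y else 0)" for z
    by auto
  then show ?case using assms 0 by simp
next
  case (Suc k)
  have "generator_pow S r (Suc (Suc k)) x y =
      (\<Sum>z\<in>S. generator S r x z * (\<Sum>v\<in>S. generator_pow S r k z v * generator S r v y))"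
    unfolding generator_pow.simps(2)[of S r "Suc k"] by (intro sum.cong refl) (simp only: Suc.IH)
  also have "\<dots> = (\<Sum>v\<in>S. \<Sum>z\<in>S. generator S r x z * generator_pow S r k z v * generator S r v y)"
    by (subst sum.swap) (simp add: sum_distrib_left mult.assoc)
  also have "\<dots> = (\<Sum>v\<in>S. generator_pow S r (Suc k) x v * generator S r v y)"
    by (simp add: sum_distrib_right)
  finally show ?case .
qed

lemma summable_transition:
  assumes "finite S" "x \<in> S"
  shows "summable (\<lambda>k. generator_pow S r k x y / fact k * t ^ k)"
proof (rule summable_comparison_test)
  let ?B = "\<Sum>x\<in>S. \<Sum>z\<in>S. \<bar>generator S r x z\<bar>"
  show "summable (\<lambda>k. inverse (fact k) * (?B * \<bar>t\<bar>) ^ k)" by (rule summable_exp)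
  have "\<bar>generator_pow S r k x y\<bar> * \<bar>t\<bar> ^ k \<le> ?B ^ k * \<bar>t\<bar> ^ k" for k
    by (intro mult_right_mono generator_pow_bound assms) auto
  then show "\<exists>M. \<forall>k\<ge>M. norm (generator_pow S r k x y / fact k * t ^ k) \<le> inverse (fact k) * (?B * \<bar>t\<bar>) ^ k"
    by (auto simp: abs_mult power_abs power_mult_distrib field_simps)
qed

lemma transition_altdef:
  "transition S r t x y = (\<Sum>k. generator_pow S r k x y / fact k * t ^ k)"
  by (simp add: transition_def mult.commute)

lemma transition_0 [simp]: "transition S r 0 x y = (if x = y then 1 else 0)"
  unfolding transition_altdef by (subst powser_zero) auto

text \<open>Kolmogorov's forward equation. Termwise differentiation shifts the power of the
  generator by one, and the extra factor splits off on the right.\<close>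

lemma DERIV_transition:
  assumes "finite S" "x \<in> S" "y \<in> S"
  shows "((\<lambda>t. transition S r t x y) has_real_derivative
           (\<Sum>z\<in>S. transition S r t x z * generator S r z y)) (at t)"
proof -
  define c where "c = (\<lambda>y k. generator_pow S r k x y / fact k)"
  have sm: "summable (\<lambda>k. c y k * t ^ k)" for y t
    unfolding c_def by (rule summable_transition[OF assms(1,2)])
  have "diffs (c y) k = (\<Sum>z\<in>S. c z k * generator S r z y)" for k
  proof -
    have "diffs (c y) k = generator_pow S r (Suc k) x y / fact k"
      by (simp add: diffs_def c_def del: generator_pow.simps)
    also have "\<dots> = (\<Sum>z\<in>S. c z k * generator S r z y)"
      by (simp only: generator_pow_Suc_right[OF assms] sum_divide_distrib) (simp add: c_def)
    finally show ?thesis .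
  qed
  then have "(\<Sum>k. diffs (c y) k * t ^ k) = (\<Sum>k. \<Sum>z\<in>S. c z k * t ^ k * generator S r z y)"
    by (simp add: sum_distrib_right sum_distrib_left mult_ac)
  also have "\<dots> = (\<Sum>z\<in>S. (\<Sum>k. c z k * t ^ k) * generator S r z y)"
    using sm by (subst suminf_sum) (auto intro!: sum.cong summable_mult2 suminf_mult2[symmetric])
  finally show ?thesis
    using termdiffs_strong_converges_everywhere[OF sm, of y t]
    by (simp add: transition_altdef c_def)
qed

text \<open>The diagonal entry is minus the total rate, so the generator acts on \<open>f\<close>
  through its increments and annihilates constants.\<close>

lemma generator_sum:
  assumes "finite S" "x \<in> S"
  shows "(\<Sum>z\<in>S. generator S r x z * f z) = (\<Sum>z\<in>S - {x}. r x z * (f z - f x))"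
proof -
  have "(\<Sum>z\<in>S. generator S r x z * f z) = generator S r x x * f x + (\<Sum>z\<in>S - {x}. generator S r x z * f z)"
    using assms by (simp add: sum.remove)
  also have "(\<Sum>z\<in>S - {x}. generator S r x z * f z) = (\<Sum>z\<in>S - {x}. r x z * f z)"
    by (intro sum.cong) (auto simp: generator_def)
  finally show ?thesis
    by (simp add: generator_def algebra_simps sum_subtractf sum_distrib_left)
qed

text \<open>The definition of the process gives joint laws that always include time 0; the joint law
  at 0 and \<open>T\<close> is therefore summed over the starting state.\<close>

lemma markov_jump_process_law:
  assumes mjp: "markov_jump_process N X S r \<mu>" and S: "finite S" and y: "y \<in> S" and T: "T > 0"
  shows "measure N {w \<in> space N. X T w = y} = (\<Sum>x\<in>S. \<mu> x * transition S r T x y)"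
proof -
  interpret prob_space N using mjp by (simp add: markov_jump_process_def)
  have [measurable]: "X t \<in> measurable N (count_space S)" if "t \<ge> 0" for t
    using mjp that by (simp add: markov_jump_process_def)
  have [measurable]: "{w \<in> space N. X t w = z} \<in> sets N" if "t \<ge> 0" for t z
    using that by measurable
  have "measure N {w \<in> space N. X 0 w = x \<and> X T w = y} = \<mu> x * transition S r T x y" if "x \<in> S" for x
  proof -
    have "measure N {w \<in> space N. \<forall>i\<le>1. X (of_nat i * T) w = (if i = 0 then x else y)} =
        \<mu> x * (\<Prod>i<(1::nat). transition S r (of_nat (Suc i) * T - of_nat i * T) (if i = 0 then x else y) (if Suc i = 0 then x else y))"
      using mjp[unfolded markov_jump_process_def, THEN conjunct2, THEN conjunct2, THEN conjunct2,
          THEN conjunct2, rule_format, of "\<lambda>i. of_nat i * T" 1 "\<lambda>i. if i = 0 then x else y"] T y that by simp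
    moreover have "(\<forall>i\<le>(1::nat). X (of_nat i * T) w = (if i = 0 then x else y)) \<longleftrightarrow> X 0 w = x \<and> X T w = y" for w
      by (auto simp: le_Suc_eq)
    ultimately show ?thesis by simp
  qed
  moreover have "measure N {w \<in> space N. X T w = y} = (\<Sum>x\<in>S. measure N {w \<in> space N. X 0 w = x \<and> X T w = y})"
  proof -
    have "{w \<in> space N. X T w = y} = (\<Union>x\<in>S. {w \<in> space N. X 0 w = x \<and> X T w = y})"
      using measurable_space[of "X 0" N "count_space S"] by auto
    then show ?thesis using S T
      by (auto intro!: finite_measure_finite_Union sets.sets_Collect_conj simp: disjoint_family_on_def)
  qed
  ultimately show ?thesis by simp
qed

text \<open>A Gronwall argument: by the forward equation and the hypothesis on \<phi>, the mean of
  \<phi> at time \<open>t\<close>, multiplied by \<open>exp (- \<kappa> * t)\<close>, has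
  nonpositive derivative.\<close>

lemma markov_jump_process_Lyapunov:
  assumes mjp: "markov_jump_process N X S r \<mu>" and S: "finite S" and T: "T > 0"
    and \<mu>: "\<And>x. x \<in> S \<Longrightarrow> \<mu> x \<ge> 0"
    and \<phi>: "\<And>x. x \<in> S \<Longrightarrow> (\<Sum>z\<in>S. generator S r x z * \<phi> z) \<le> \<kappa> * \<phi> x"
  shows "(\<Sum>x\<in>S. measure N {w \<in> space N. X T w = x} * \<phi> x) \<le> exp (\<kappa> * T) * (\<Sum>x\<in>S. \<mu> x * \<phi> x)"
proof -
  \<comment> \<open>Defined by the power series, \<open>p\<close> is differentiable at every real
    time, including 0. For positive times it is the law of the process, whence the nonnegativity by
    which the inequality for \<phi> is multiplied.\<close>
  define p where "p t y = (\<Sum>x\<in>S. \<mu> x * transition S r t x y)" for t y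
  define u where "u t = exp (- \<kappa> * t) * (\<Sum>y\<in>S. p t y * \<phi> y)" for t
  have p_law: "p t y = measure N {w \<in> space N. X t w = y}" if "t > 0" "y \<in> S" for t y
    using markov_jump_process_law[OF mjp S that(2,1)] by (simp add: p_def)
  have p_0: "p 0 y = \<mu> y" if "y \<in> S" for y
  proof -
    have "\<mu> x * (if x = y then 1 else 0) = (if x = y then \<mu> x else 0)" for x by simp
    then show ?thesis using S that by (simp add: p_def)
  qed
  have p_nonneg: "p t y \<ge> 0" if "t \<ge> 0" "y \<in> S" for t y
    using p_law[of t y] p_0[of y] \<mu> that by (cases "t = 0") auto
  have "u T \<le> u 0"
  proof (rule DERIV_nonpos_imp_nonincreasing[of 0 T u])
    fix t assume t: "0 \<le> t" "t \<le> T"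
    have dp: "((\<lambda>t. p t y) has_real_derivative (\<Sum>z\<in>S. p t z * generator S r z y)) (at t)" if "y \<in> S" for y
    proof -
      have "((\<lambda>t. p t y) has_real_derivative
          (\<Sum>x\<in>S. \<mu> x * (\<Sum>z\<in>S. transition S r t x z * generator S r z y))) (at t)"
        unfolding p_def by (intro DERIV_sum DERIV_cmult DERIV_transition S that)
      also have "(\<Sum>x\<in>S. \<mu> x * (\<Sum>z\<in>S. transition S r t x z * generator S r z y)) = (\<Sum>z\<in>S. p t z * generator S r z y)"
        unfolding p_def sum_distrib_left sum_distrib_right
        by (subst sum.swap) (simp add: mult_ac)
      finally show ?thesis .
    qed
    have "(\<Sum>y\<in>S. (\<Sum>z\<in>S. p t z * generator S r z y) * \<phi> y) = (\<Sum>z\<in>S. p t z * (\<Sum>y\<in>S. generator S r z y * \<phi> y))"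
      unfolding sum_distrib_left sum_distrib_right by (subst sum.swap) (simp add: mult_ac)
    also have "\<dots> \<le> (\<Sum>z\<in>S. p t z * (\<kappa> * \<phi> z))"
      using p_nonneg t by (intro sum_mono mult_left_mono \<phi>) auto
    also have "\<dots> = \<kappa> * (\<Sum>y\<in>S. p t y * \<phi> y)" by (simp add: sum_distrib_left mult_ac)
    finally have le: "(\<Sum>y\<in>S. (\<Sum>z\<in>S. p t z * generator S r z y) * \<phi> y) \<le> \<kappa> * (\<Sum>y\<in>S. p t y * \<phi> y)" .
    have "(u has_real_derivative (exp (- \<kappa> * t) * (\<Sum>y\<in>S. (\<Sum>z\<in>S. p t z * generator S r z y) * \<phi> y)
         + exp (- \<kappa> * t) * (- \<kappa>) * (\<Sum>y\<in>S. p t y * \<phi> y))) (at t)"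
      unfolding u_def
    proof (rule DERIV_mult')
      show "((\<lambda>t. exp (- \<kappa> * t)) has_real_derivative exp (- \<kappa> * t) * (- \<kappa>)) (at t)"
        by (auto intro!: derivative_eq_intros)
      show "((\<lambda>t. \<Sum>y\<in>S. p t y * \<phi> y) has_real_derivative
          (\<Sum>y\<in>S. (\<Sum>z\<in>S. p t z * generator S r z y) * \<phi> y)) (at t)"
        by (intro DERIV_sum DERIV_cmult_right dp)
    qed
    moreover have "exp (- \<kappa> * t) * (\<Sum>y\<in>S. (\<Sum>z\<in>S. p t z * generator S r z y) * \<phi> y)
         + exp (- \<kappa> * t) * (- \<kappa>) * (\<Sum>y\<in>S. p t y * \<phi> y) \<le> 0"
      using mult_left_mono[OF le, of "exp (- \<kappa> * t)"] by (simp add: mult_ac)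
    ultimately show "\<exists>D. (u has_real_derivative D) (at t) \<and> D \<le> 0" by blast
  qed (use T in auto)
  then have "exp (- (\<kappa> * T)) * (\<Sum>y\<in>S. p T y * \<phi> y) \<le> (\<Sum>x\<in>S. \<mu> x * \<phi> x)"
    using p_0 by (simp add: u_def)
  then have "exp (\<kappa> * T) * (exp (- (\<kappa> * T)) * (\<Sum>y\<in>S. p T y * \<phi> y)) \<le> exp (\<kappa> * T) * (\<Sum>x\<in>S. \<mu> x * \<phi> x)"
    by (rule mult_left_mono) simp
  moreover have "exp (\<kappa> * T) * (exp (- (\<kappa> * T)) * z) = z" for z :: real
    by (simp add: exp_minus field_simps)
  ultimately show ?thesis using p_law T by simp
qed

text \<open>A path that is constant on the interval is constant along a grid of mesh
  \<open>h\<close>. The Markov property gives this weaker event the probability of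
  \<open>X T w = x\<close> times the \<open>k\<close>-th power of the diagonal transition
  probability, and refining the grid yields the exponential holding time bound.\<close>

lemma markov_jump_process_constant_le:
  assumes mjp: "markov_jump_process N X S r \<mu>" and S: "finite S" and T: "T > 0" and s: "s > 0"
  shows "measure N {w \<in> space N. \<forall>u. T \<le> u \<and> u < T + s \<longrightarrow> X u w = X T w} \<le>
    (\<Sum>x\<in>S. measure N {w \<in> space N. X T w = x} * exp (- (\<Sum>z\<in>S - {x}. r x z) * s))"
proof -
  interpret prob_space N using mjp by (simp add: markov_jump_process_def)
  have [measurable]: "X t \<in> measurable N (count_space S)" if "t \<ge> 0" for t
    using mjp that by (simp add: markov_jump_process_def)
  have meas: "{w \<in> space N. X t w = z} \<in> sets N" if "t \<ge> 0" for t z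
    using that by measurable
  \<comment> \<open>The times \<open>T + i h\<^sub>k\<close>, \<open>i \<le> k\<close>, stay strictly below \<open>T + s\<close>.\<close>
  define h where "h k = s / real (Suc k)" for k
  have h: "h k > 0" for k using s by (simp add: h_def)
  define J where "J k x = {w \<in> space N. \<forall>i\<le>k. X (T + of_nat i * h k) w = x}" for k x
  have J_meas: "J k x \<in> sets N" for k x
    unfolding J_def using T h by (intro sets.sets_Collect_countable_All sets.sets_Collect_imp meas
      sets.sets_Collect_const) (auto intro!: add_nonneg_nonneg mult_nonneg_nonneg simp: less_imp_le simp del: of_nat_mult)
  have J_prob: "measure N (J k x) = measure N {w \<in> space N. X T w = x} * transition S r (h k) x x ^ k"
    if x: "x \<in> S" for k x
  proof -
    \<comment> \<open>Index 0 is time 0, which the definition of the process demands; the grid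
      occupies the indices from 1 on, hence the shift \<open>i - 1\<close>.\<close>
    define t where "t = (\<lambda>i::nat. if i = 0 then 0 else T + of_nat (i - 1) * h k)"
    have *: "measure N {w \<in> space N. X 0 w = y \<and> w \<in> J k x} = \<mu> y * transition S r T y x * transition S r (h k) x x ^ k"
      if y: "y \<in> S" for y
    proof -
      define g where "g = (\<lambda>i::nat. if i = 0 then y else x)"
      have "\<forall>i<Suc k. t i < t (Suc i)"
        using T h[of k] by (auto simp: t_def algebra_simps of_nat_diff)
      then have "measure N {w \<in> space N. \<forall>i\<le>Suc k. X (t i) w = g i} =
        \<mu> (g 0) * (\<Prod>i<Suc k. transition S r (t (Suc i) - t i) (g i) (g (Suc i)))"
        using mjp[unfolded markov_jump_process_def, THEN conjunct2, THEN conjunct2, THEN conjunct2,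
          THEN conjunct2, rule_format, of t "Suc k" g] x y by (simp add: t_def g_def)
      also have "(\<Prod>i<Suc k. transition S r (t (Suc i) - t i) (g i) (g (Suc i))) =
         transition S r T y x * (\<Prod>i<k. transition S r (h k) x x)"
        unfolding prod.lessThan_Suc_shift
        by (intro arg_cong2[of _ _ _ _ "(*)"] prod.cong) (auto simp: t_def g_def algebra_simps)
      also have "{w \<in> space N. \<forall>i\<le>Suc k. X (t i) w = g i} = {w \<in> space N. X 0 w = y \<and> w \<in> J k x}"
      proof -
        have "(\<forall>i\<le>Suc k. Q i) \<longleftrightarrow> Q 0 \<and> (\<forall>i\<le>k. Q (Suc i))" for Q
          by (metis Suc_le_mono le0 not0_implies_Suc)
        then show ?thesis by (auto simp: J_def t_def g_def)
      qed
      finally show ?thesis by (simp add: g_def)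
    qed
    have "J k x = (\<Union>y\<in>S. {w \<in> space N. X 0 w = y \<and> w \<in> J k x})"
      using measurable_space[of "X 0" N "count_space S"] by (auto simp: J_def)
    then have "measure N (J k x) = measure N (\<Union>y\<in>S. {w \<in> space N. X 0 w = y \<and> w \<in> J k x})" by simp
    also have "\<dots> = (\<Sum>y\<in>S. measure N {w \<in> space N. X 0 w = y \<and> w \<in> J k x})"
    proof (rule finite_measure_finite_Union[OF S])
      have "{w \<in> space N. X 0 w = y \<and> w \<in> J k x} = {w \<in> space N. X 0 w = y} \<inter> J k x" for y
        by auto
      then show "(\<lambda>y. {w \<in> space N. X 0 w = y \<and> w \<in> J k x}) ` S \<subseteq> events"
        using J_meas meas by auto
    qed (auto simp: disjoint_family_on_def)
    also have "\<dots> = (\<Sum>y\<in>S. \<mu> y * transition S r T y x) * transition S r (h k) x x ^ k"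
      by (simp add: * sum_distrib_right)
    finally show ?thesis using markov_jump_process_law[OF mjp S x T] by simp
  qed
  have le: "measure N {w \<in> space N. \<forall>u. T \<le> u \<and> u < T + s \<longrightarrow> X u w = X T w} \<le>
    (\<Sum>x\<in>S. measure N {w \<in> space N. X T w = x} * transition S r (h k) x x ^ k)" for k
  proof -
    have "{w \<in> space N. \<forall>u. T \<le> u \<and> u < T + s \<longrightarrow> X u w = X T w} \<subseteq> (\<Union>x\<in>S. J k x)"
    proof
      fix w assume w: "w \<in> {w \<in> space N. \<forall>u. T \<le> u \<and> u < T + s \<longrightarrow> X u w = X T w}"
      have "real i * s < s * real (Suc k)" if "i \<le> k" for i using s that by (simp add: mult.commute)
      then have "real i * h k < s" if "i \<le> k" for i
        using that by (simp add: h_def field_simps)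
      then have "w \<in> J k (X T w)" using w h[of k] by (auto simp: J_def)
      moreover have "X T w \<in> S" using w measurable_space[of "X T" N "count_space S"] T by auto
      ultimately show "w \<in> (\<Union>x\<in>S. J k x)" by auto
    qed
    then have "measure N {w \<in> space N. \<forall>u. T \<le> u \<and> u < T + s \<longrightarrow> X u w = X T w} \<le> measure N (\<Union>x\<in>S. J k x)"
      using J_meas S by (intro finite_measure_mono) auto
    also have "\<dots> \<le> (\<Sum>x\<in>S. measure N (J k x))"
      using J_meas S by (intro finite_measure_subadditive_finite) auto
    finally show ?thesis using J_prob by simp
  qed
  \<comment> \<open>The inequality \<open>1 + y \<le> exp y\<close> turns the power into an
    exponential; the base is positive for small \<open>h\<close>, so powers are monotone. The
    exponent converges because the diagonal of the transition function has derivative minus the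
    total rate at 0.\<close>
  have ev: "\<forall>\<^sub>F k in sequentially. transition S r (h k) x x ^ k \<le> exp (real k * (transition S r (h k) x x - 1))"
    and lim: "(\<lambda>k. exp (real k * (transition S r (h k) x x - 1))) \<longlonglongrightarrow> exp (- (\<Sum>z\<in>S - {x}. r x z) * s)"
    if x: "x \<in> S" for x
  proof -
    have h0: "h \<longlonglongrightarrow> 0" unfolding h_def
      using tendsto_mult[OF tendsto_const[of s] LIMSEQ_inverse_real_of_nat] by (simp add: divide_inverse)
    then have h0': "filterlim h (at 0) sequentially"
      using less_imp_neq[OF h] by (auto simp: filterlim_at)
    have "(\<Sum>z\<in>S. transition S r 0 x z * generator S r z x) = generator S r x x"
    proof -
      have "transition S r 0 x z * generator S r z x = (if x = z then generator S r z x else 0)" for z by simp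
      then show ?thesis using S x by simp
    qed
    then have D: "((\<lambda>t. transition S r t x x) has_real_derivative generator S r x x) (at 0)"
      using DERIV_transition[OF S x x, of r 0] by simp
    have "(\<lambda>k. transition S r (h k) x x) \<longlonglongrightarrow> transition S r 0 x x"
      by (rule isCont_tendsto_compose[OF DERIV_isCont[OF D] h0])
    then have "\<forall>\<^sub>F k in sequentially. transition S r (h k) x x > 0"
      by (rule order_tendstoD) simp
    then show "\<forall>\<^sub>F k in sequentially. transition S r (h k) x x ^ k \<le> exp (real k * (transition S r (h k) x x - 1))"
    proof eventually_elim
      case (elim k)
      have "transition S r (h k) x x \<le> exp (transition S r (h k) x x - 1)"
        using exp_ge_add_one_self[of "transition S r (h k) x x - 1"] by simp
      then have "transition S r (h k) x x ^ k \<le> exp (transition S r (h k) x x - 1) ^ k"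
        using elim by (intro power_mono) auto
      then show ?case by (simp add: exp_of_nat_mult)
    qed
    have "((\<lambda>t. (transition S r t x x - 1) / t) \<longlongrightarrow> generator S r x x) (at 0)"
      using D[unfolded DERIV_def] by simp
    then have "(\<lambda>k. (transition S r (h k) x x - 1) / h k) \<longlonglongrightarrow> generator S r x x"
      using h0' by (rule filterlim_compose)
    moreover have "(\<lambda>k. real k / real (Suc k)) \<longlonglongrightarrow> 1"
      by (rule LIMSEQ_n_over_Suc_n)
    ultimately have "(\<lambda>k. (transition S r (h k) x x - 1) / h k * (s * (real k / real (Suc k)))) \<longlonglongrightarrow> generator S r x x * (s * 1)"
      by (intro tendsto_intros)
    \<comment> \<open>As \<open>h k = s / (k + 1)\<close>, the exponent is the difference quotient
      at 0 times a factor tending to \<open>s\<close>.\<close>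
    moreover have "(transition S r (h k) x x - 1) / h k * (s * (real k / real (Suc k))) = real k * (transition S r (h k) x x - 1)" for k
    proof -
      have "p / (s / z) * (s * (y / z)) = y * p" if "z > 0" for p y z :: real
        using s that by (simp add: field_simps)
      then show ?thesis by (simp add: h_def)
    qed
    ultimately have "(\<lambda>k. real k * (transition S r (h k) x x - 1)) \<longlonglongrightarrow> generator S r x x * (s * 1)"
      by (simp only:)
    then show "(\<lambda>k. exp (real k * (transition S r (h k) x x - 1))) \<longlonglongrightarrow> exp (- (\<Sum>z\<in>S - {x}. r x z) * s)"
      by (intro tendsto_exp) (simp add: generator_def)
  qed
  \<comment> \<open>Finiteness of \<open>S\<close> provides one threshold for \<open>k\<close> that
    serves all states.\<close>
  have "\<forall>\<^sub>F k in sequentially. \<forall>x\<in>S. transition S r (h k) x x ^ k \<le> exp (real k * (transition S r (h k) x x - 1))"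
    using ev S by (intro eventually_ball_finite) auto
  then have "\<forall>\<^sub>F k in sequentially. measure N {w \<in> space N. \<forall>u. T \<le> u \<and> u < T + s \<longrightarrow> X u w = X T w} \<le>
    (\<Sum>x\<in>S. measure N {w \<in> space N. X T w = x} * exp (real k * (transition S r (h k) x x - 1)))"
  proof eventually_elim
    case (elim k)
    then show ?case
      by (intro order_trans[OF le[of k]] sum_mono mult_left_mono) auto
  qed
  moreover have "(\<lambda>k. \<Sum>x\<in>S. measure N {w \<in> space N. X T w = x} * exp (real k * (transition S r (h k) x x - 1)))
     \<longlonglongrightarrow> (\<Sum>x\<in>S. measure N {w \<in> space N. X T w = x} * exp (- (\<Sum>z\<in>S - {x}. r x z) * s))"
    by (intro tendsto_sum tendsto_mult tendsto_const lim)
  ultimately show ?thesis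
    by (intro tendsto_lowerbound[where F = sequentially]) auto
qed


section \<open>Analysis on the discrete cube\<close>

definition flip :: "nat \<Rightarrow> (nat \<Rightarrow> real) \<Rightarrow> nat \<Rightarrow> real" where
  "flip i x = x(i := - x i)"

lemma flip_flip [simp]: "flip i (flip i x) = x"
  by (auto simp: flip_def)

lemma cube_values: "x \<in> cube n \<Longrightarrow> i < n \<Longrightarrow> x i = 1 \<or> x i = - 1"
  unfolding cube_def by (drule PiE_mem[of _ _ _ i]) auto

lemma flip_in_cube: "x \<in> cube n \<Longrightarrow> i < n \<Longrightarrow> flip i x \<in> cube n"
  using cube_values[of x n i] by (auto simp: flip_def cube_def PiE_iff extensional_def)

lemma finite_cube [simp]: "finite (cube n)"
  by (auto simp: cube_def intro: finite_PiE)

lemma card_cube: "card (cube n) = 2 ^ n"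
  by (simp add: cube_def card_PiE numeral_2_eq_2)

lemma cube_nonempty: "cube n \<noteq> {}"
  using card_cube[of n] by auto

text \<open>A flip is an involution of the cube; this makes the uniform measure invariant under the
  simple random walk.\<close>

lemma sum_flip:
  assumes "i < n" shows "(\<Sum>x\<in>cube n. f (flip i x)) = (\<Sum>x\<in>cube n. f x)"
  by (rule sum.reindex_bij_witness[of _ "flip i" "flip i"]) (use assms in \<open>auto intro: flip_in_cube\<close>)

lemma cube_edge_iff_flip: "cube_edge n x y \<longleftrightarrow> x \<in> cube n \<and> (\<exists>i<n. y = flip i x)"
proof safe
  assume *: "cube_edge n x y"
  then show "x \<in> cube n" by (simp add: cube_edge_def)
  from * obtain i where i: "{j \<in> {..<n}. x j \<noteq> y j} = {i}"
    by (auto simp: cube_edge_def card_1_singleton_iff)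
  have xy: "x \<in> cube n" "y \<in> cube n" using * by (auto simp: cube_edge_def)
  have "i < n" "x i \<noteq> y i" using i by auto
  moreover have "y j = flip i x j" for j
  proof (cases "j < n")
    case True
    show ?thesis
    proof (cases "j = i")
      case True
      then show ?thesis using cube_values[OF xy(1), of i] cube_values[OF xy(2), of i] \<open>i < n\<close> \<open>x i \<noteq> y i\<close>
        by (auto simp: flip_def)
    next
      case False
      then have "j \<notin> {j \<in> {..<n}. x j \<noteq> y j}" using i by simp
      then show ?thesis using True False by (simp add: flip_def)
    qed
  next
    \<comment> \<open>Outside \<open>{..<n}\<close> both points equal \<open>undefined\<close>,
      since \<open>cube\<close> consists of extensional functions.\<close>
    case False
    then show ?thesis using xy \<open>i < n\<close> by (auto simp: cube_def PiE_iff extensional_def flip_def)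
  qed
  ultimately show "\<exists>i<n. y = flip i x" by auto
next
  fix i assume "x \<in> cube n" "i < n"
  moreover from this have "{j \<in> {..<n}. x j \<noteq> flip i x j} = {i}"
    using cube_values[of x n i] by (auto simp: flip_def)
  ultimately show "cube_edge n x (flip i x)" by (simp add: cube_edge_def flip_in_cube)
qed

text \<open>The neighbours of \<open>x\<close> are its \<open>n\<close> distinct flips. With
  \<open>g = 1\<close> this gives the total rate 1 / \<tau>; with increments of a function it gives
  the generator in the form (P - 1) / \<tau>.\<close>

lemma sum_jump_rate:
  assumes x: "x \<in> cube n"
  shows "(\<Sum>z\<in>cube n - {x}. jump_rate \<beta> H n \<omega> x z * g z) = (\<Sum>i<n. g (flip i x)) / (real n * tau \<beta> H n x \<omega>)"
proof -
  have neq: "flip i x i \<noteq> x i" if "i < n" for i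
    using cube_values[OF x that] by (auto simp: flip_def)
  have inj: "inj_on (\<lambda>i. flip i x) {..<n}"
  proof (rule inj_onI)
    fix i j assume "i \<in> {..<n}" "j \<in> {..<n}" "flip i x = flip j x"
    then show "i = j" using neq[of i] by (metis flip_def fun_upd_other lessThan_iff)
  qed
  have "(\<Sum>z\<in>cube n - {x}. jump_rate \<beta> H n \<omega> x z * g z) =
      (\<Sum>z\<in>(\<lambda>i. flip i x) ` {..<n}. g z / (real n * tau \<beta> H n x \<omega>))"
    using x neq by (intro sum.mono_neutral_cong_right)
      (auto simp: jump_rate_def cube_edge_iff_flip flip_in_cube, metis)
  also have "\<dots> = (\<Sum>i<n. g (flip i x) / (real n * tau \<beta> H n x \<omega>))"
    using inj by (simp add: sum.reindex)
  finally show ?thesis by (simp add: sum_divide_distrib)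
qed

text \<open>Each of the \<open>n\<close> products is at most 1, so their average can be 1 only if
  all of them are 1.\<close>

lemma inner_prod_eq_imp_eq:
  assumes "x \<in> cube n" "y \<in> cube n" "n \<ge> 1" "inner_prod n x y / real n = 1"
  shows "x = y"
proof -
  have le: "x i * y i \<le> 1" if "i < n" for i
    using cube_values[OF assms(1) that] cube_values[OF assms(2) that] by auto
  have "(\<Sum>i<n. 1 - x i * y i) = 0"
    using assms(3,4) by (simp add: inner_prod_def sum_subtractf field_simps)
  then have "\<forall>i<n. 1 - x i * y i = 0"
    using le by (subst (asm) sum_nonneg_eq_0_iff) auto
  then have "x i = y i" if "i < n" for i
    using cube_values[OF assms(1) that] cube_values[OF assms(2) that] that by auto
  then show ?thesis
    using assms(1,2) unfolding cube_def by (intro PiE_ext) auto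
qed

section \<open>The Poincare inequality of the cube\<close>

lemma sum_cube_Suc:
  fixes f :: "(nat \<Rightarrow> real) \<Rightarrow> real"
  shows "(\<Sum>x\<in>cube (Suc n). f x) = (\<Sum>x\<in>cube n. f (x(n := 1))) + (\<Sum>x\<in>cube n. f (x(n := - 1)))"
proof -
  let ?g = "\<lambda>(y, x). x(n := y)"
  have inj: "inj_on ?g ({-1, 1} \<times> cube n)"
    unfolding cube_def using inj_combinator[of n "{..<n}" "\<lambda>_. {-1, 1::real}"] by simp
  have "cube (Suc n) = ?g ` ({-1, 1} \<times> cube n)"
    unfolding cube_def lessThan_Suc by (rule PiE_insert_eq)
  then have "(\<Sum>x\<in>cube (Suc n). f x) = (\<Sum>p\<in>{-1, 1} \<times> cube n. f (?g p))"
    using inj by (simp add: sum.reindex)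
  also have "\<dots> = (\<Sum>v\<in>{-1, 1}. \<Sum>x\<in>cube n. f (x(n := v)))"
    by (subst sum.cartesian_product) (simp add: case_prod_unfold)
  finally show ?thesis by simp
qed

text \<open>The variance is at most a quarter of the mean of the summed squared differences along
  edges; both sides are multiplied by \<open>4 ^ n\<close> to clear denominators. The constant is
  sharp (take a coordinate function). Induction over the dimension splits the cube into two opposite
  faces.\<close>

lemma cube_Poincare:
  fixes f :: "(nat \<Rightarrow> real) \<Rightarrow> real"
  shows "2 ^ n * (\<Sum>x\<in>cube n. (f x)\<^sup>2) - (\<Sum>x\<in>cube n. f x)\<^sup>2 \<le>
    2 ^ n / 4 * (\<Sum>x\<in>cube n. \<Sum>i<n. (f x - f (flip i x))\<^sup>2)"
proof (induction n arbitrary: f)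
  case 0
  then show ?case by (simp add: cube_def)
next
  case (Suc n)
  define p where "p = (\<lambda>x. f (x(n := 1)))"
  define q where "q = (\<lambda>x. f (x(n := - 1)))"
  define D where "D g = (\<Sum>x\<in>cube n. \<Sum>i<n. (g x - g (flip i x))\<^sup>2)" for g :: "(nat \<Rightarrow> real) \<Rightarrow> real"
  define E where "E = (\<Sum>x\<in>cube n. (p x - q x)\<^sup>2)"
  have fl: "flip i (x(n := v)) = (flip i x)(n := v)" if "i < n" for i x v
    using that by (auto simp: flip_def)
  have fn: "flip n (x(n := v)) = x(n := - v)" for x v
    by (auto simp: flip_def)
  \<comment> \<open>An edge in direction \<open>n\<close> is met from both of its ends, hence the
    factor 2 of \<open>E\<close>.\<close>
  have eq: "(\<Sum>x\<in>cube (Suc n). \<Sum>i<Suc n. (f x - f (flip i x))\<^sup>2) = D p + D q + 2 * E"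
  proof -
    have "(\<Sum>x\<in>cube n. (f (x(n := - 1)) - f (x(n := 1)))\<^sup>2) = E"
      unfolding E_def p_def q_def by (intro sum.cong refl power2_commute)
    moreover have "(\<Sum>x\<in>cube n. (f (x(n := 1)) - f (x(n := - 1)))\<^sup>2) = E"
      by (simp add: E_def p_def q_def)
    ultimately show ?thesis
      by (simp add: sum_cube_Suc fn fl D_def p_def q_def sum.distrib)
  qed
  have cs: "((\<Sum>x\<in>cube n. p x) - (\<Sum>x\<in>cube n. q x))\<^sup>2 \<le> 2 ^ n * E"
  proof -
    have "((\<Sum>x\<in>cube n. p x) - (\<Sum>x\<in>cube n. q x))\<^sup>2 = (\<Sum>x\<in>cube n. 1 * (p x - q x))\<^sup>2"
      by (simp add: sum_subtractf)
    also have "\<dots> \<le> (\<Sum>x\<in>cube n. 1\<^sup>2) * (\<Sum>x\<in>cube n. (p x - q x)\<^sup>2)"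
      by (rule Cauchy_Schwarz_ineq_sum)
    finally show ?thesis by (simp add: card_cube E_def)
  qed
  \<comment> \<open>The variance splits into the variances on the two faces and the squared
    difference of the face sums, which Cauchy-Schwarz bounds by the edges between the faces.\<close>
  have "2 ^ Suc n * (\<Sum>x\<in>cube (Suc n). (f x)\<^sup>2) - (\<Sum>x\<in>cube (Suc n). f x)\<^sup>2 =
      2 * (2 ^ n * (\<Sum>x\<in>cube n. (p x)\<^sup>2) - (\<Sum>x\<in>cube n. p x)\<^sup>2) +
      2 * (2 ^ n * (\<Sum>x\<in>cube n. (q x)\<^sup>2) - (\<Sum>x\<in>cube n. q x)\<^sup>2) +
      ((\<Sum>x\<in>cube n. p x) - (\<Sum>x\<in>cube n. q x))\<^sup>2"
    by (simp add: sum_cube_Suc p_def q_def algebra_simps power2_eq_square)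
  also have "\<dots> \<le> 2 * (2 ^ n / 4 * D p) + 2 * (2 ^ n / 4 * D q) + 2 ^ n * E"
    using Suc[of p] Suc[of q] cs by (simp add: D_def)
  also have "\<dots> = 2 ^ Suc n / 4 * (D p + D q + 2 * E)"
    by (simp add: algebra_simps)
  finally show ?case unfolding eq .
qed

text \<open>Monotone iteration: the equation is a fixed point equation for the order preserving map
  \<open>G\<close>. Its iterates from 0 increase and stay below a constant supersolution, so they
  converge pointwise, and the limit is a fixed point.\<close>

lemma cube_resolvent_exists:
  fixes V f :: "(nat \<Rightarrow> real) \<Rightarrow> real"
  assumes V: "\<And>x. x \<in> cube n \<Longrightarrow> V x > 0" and f: "\<And>x. x \<in> cube n \<Longrightarrow> f x \<ge> 0" and n: "n \<ge> 1"
  shows "\<exists>\<phi>. \<forall>x\<in>cube n. \<phi> x \<ge> 0 \<and> (1 + V x) * \<phi> x = (\<Sum>i<n. \<phi> (flip i x)) / n + f x"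
proof -
  define G where "G \<phi> x = ((\<Sum>i<n. \<phi> (flip i x)) / n + f x) / (1 + V x)" for \<phi> x
  define F where "F k = (G ^^ k) (\<lambda>_. 0)" for k
  have F_Suc: "F (Suc k) = G (F k)" and F_0: "F 0 = (\<lambda>_. 0)" for k by (auto simp: F_def)
  have G_mono: "G \<phi> x \<le> G \<psi> x" if "\<And>x. x \<in> cube n \<Longrightarrow> \<phi> x \<le> \<psi> x" "x \<in> cube n" for \<phi> \<psi> x
    unfolding G_def using that V[OF that(2)]
    by (intro divide_right_mono add_right_mono sum_mono) (auto intro: flip_in_cube)
  have pos: "F k x \<ge> 0" if "x \<in> cube n" for k x
    using that
  proof (induction k arbitrary: x)
    case (Suc k)
    then show ?case using V[of x] f[of x] n
      by (auto simp: F_Suc G_def intro!: divide_nonneg_pos add_nonneg_nonneg sum_nonneg flip_in_cube)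
  qed (simp add: F_0)
  have inc: "F k x \<le> F (Suc k) x" if "x \<in> cube n" for k x
    using that
  proof (induction k arbitrary: x)
    case 0
    then show ?case using pos[of x 1] by (simp add: F_0)
  next
    case (Suc k)
    show ?case unfolding F_Suc[of "Suc k"] F_Suc[of k]
      by (rule G_mono) (use Suc in \<open>auto simp flip: F_Suc\<close>)
  qed
  \<comment> \<open>Any constant \<open>B\<close> with \<open>f x \<le> B * V x\<close> on the cube
    satisfies \<open>G B \<le> B\<close>; the sum is a simple upper bound for the ratios
    \<open>f x / V x\<close>.\<close>
  define B where "B = (\<Sum>x\<in>cube n. f x / V x)"
  have B: "f x \<le> B * V x" if "x \<in> cube n" for x
  proof -
    have "f x / V x \<le> B" unfolding B_def
      using that V f by (intro member_le_sum) (auto simp: less_imp_le)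
    then show ?thesis using V[OF that] by (simp add: field_simps)
  qed
  have bd: "F k x \<le> B" if "x \<in> cube n" for k x
    using that
  proof (induction k arbitrary: x)
    case 0
    then show ?case using V f by (auto simp: F_0 B_def less_imp_le intro!: sum_nonneg divide_nonneg_nonneg)
  next
    case (Suc k)
    have "F (Suc k) x \<le> G (\<lambda>_. B) x" unfolding F_Suc by (rule G_mono) (use Suc in auto)
    also have "\<dots> \<le> B" using B[OF Suc.prems] V[OF Suc.prems] n by (simp add: G_def field_simps)
    finally show ?case .
  qed
  define \<phi> where "\<phi> x = lim (\<lambda>k. F k x)" for x
  have lim: "(\<lambda>k. F k x) \<longlonglongrightarrow> \<phi> x" if "x \<in> cube n" for x
  proof -
    have "incseq (\<lambda>k. F k x)" using inc[OF that] by (rule incseq_SucI)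
    moreover have "Bseq (\<lambda>k. F k x)"
      using pos[OF that] bd[OF that] by (intro BseqI'[of _ B]) auto
    ultimately have "convergent (\<lambda>k. F k x)" by (auto intro: Bseq_monoseq_convergent incseq_imp_monoseq)
    then show ?thesis by (simp add: \<phi>_def convergent_LIMSEQ_iff)
  qed
  show ?thesis
  proof (intro exI[of _ \<phi>] ballI conjI)
    fix x assume x: "x \<in> cube n"
    show "\<phi> x \<ge> 0" using pos[OF x] by (intro LIMSEQ_le_const[OF lim[OF x]]) auto
    have "(\<lambda>k. G (F k) x) \<longlonglongrightarrow> G \<phi> x"
      unfolding G_def using n V[OF x]
      by (intro tendsto_intros lim) (auto intro: flip_in_cube x)
    moreover have "(\<lambda>k. F (Suc k) x) \<longlonglongrightarrow> \<phi> x" using lim[OF x] by (rule LIMSEQ_Suc)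
    ultimately have "\<phi> x = G \<phi> x" unfolding F_Suc by (rule LIMSEQ_unique[symmetric])
    then show "(1 + V x) * \<phi> x = (\<Sum>i<n. \<phi> (flip i x)) / n + f x"
      using V[OF x] by (simp add: G_def field_simps)
  qed
qed

text \<open>Cauchy-Schwarz on \<open>A\<close>. With \<open>m\<close> the mean of \<open>f\<close>,
  it compares the sum over a subset with its expected share at the cost of the variance.\<close>

lemma cube_sum_deviation:
  fixes f :: "(nat \<Rightarrow> real) \<Rightarrow> real" and m :: real
  assumes "A \<subseteq> cube n"
  shows "\<bar>(\<Sum>x\<in>A. f x) - card A * m\<bar> \<le> sqrt (card A * (\<Sum>x\<in>cube n. (f x - m)\<^sup>2))"
proof -
  have "((\<Sum>x\<in>A. f x) - card A * m)\<^sup>2 = (\<Sum>x\<in>A. 1 * (f x - m))\<^sup>2"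
    by (simp add: sum_subtractf)
  also have "\<dots> \<le> (\<Sum>x\<in>A. 1\<^sup>2) * (\<Sum>x\<in>A. (f x - m)\<^sup>2)"
    by (rule Cauchy_Schwarz_ineq_sum)
  also have "\<dots> \<le> card A * (\<Sum>x\<in>cube n. (f x - m)\<^sup>2)"
    using assms by (auto intro!: mult_left_mono sum_mono2)
  finally show ?thesis using real_le_rsqrt by (metis power2_abs)
qed

text \<open>The arithmetic behind the bound on the mean \<open>m\<close> of the supersolution, with
  normalized variance \<open>v\<close> and with \<open>a\<close>, \<open>b\<close> the fractions of
  vertices in two sets. The first inequality is solved for \<open>v\<close>, the second for
  \<open>m\<close>.\<close>

lemma mean_le_if_variance_le:
  fixes a b w v m n :: real
  assumes "a \<ge> 0" "b > 0" "w > 0" "v \<ge> 0" "m \<ge> 0" "n \<ge> 0"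
    and v: "v \<le> n * (m * a + sqrt (a * v))" and m: "w * (m * b - sqrt (b * v)) \<le> 2 * a"
  shows "m \<le> 4 * a / (w * b) + 2 * n * a / b + 2 * n * sqrt (a / b)"
proof -
  have amgm: "sqrt (x * y) \<le> (x + y) / 2" if "x \<ge> 0" "y \<ge> 0" for x y :: real
    by (rule arith_geo_mean_sqrt) (use that in auto)
  have "n * sqrt (a * v) = sqrt (n\<^sup>2 * a * v)"
    using assms by (simp add: real_sqrt_mult)
  also have "\<dots> \<le> (n\<^sup>2 * a + v) / 2" by (rule amgm) (use assms in auto)
  finally have "v \<le> 2 * n * m * a + n\<^sup>2 * a" using v by (simp add: algebra_simps)
  then have "v / b \<le> m * (2 * n * a / b) + n\<^sup>2 * (a / b)"
    using assms by (simp add: field_simps)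
  then have "sqrt (v / b) \<le> sqrt (m * (2 * n * a / b) + n\<^sup>2 * (a / b))" by simp
  also have "\<dots> \<le> sqrt (m * (2 * n * a / b)) + sqrt (n\<^sup>2 * (a / b))"
    using assms by (intro sqrt_add_le_add_sqrt) auto
  \<comment> \<open>The AM-GM inequality is applied so that \<open>m\<close> appears with
    coefficient 1/2; moving that half to the left doubles the other constants.\<close>
  also have "\<dots> \<le> (m + 2 * n * a / b) / 2 + n * sqrt (a / b)"
  proof (rule add_mono)
    show "sqrt (m * (2 * n * a / b)) \<le> (m + 2 * n * a / b) / 2" using assms by (intro amgm) auto
    show "sqrt (n\<^sup>2 * (a / b)) \<le> n * sqrt (a / b)" unfolding real_sqrt_mult using assms by simp
  qed
  finally have 1: "sqrt (v / b) \<le> (m + 2 * n * a / b) / 2 + n * sqrt (a / b)" .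
  have "sqrt (b * v) = b * sqrt (v / b)"
  proof -
    have "sqrt (b * v) = sqrt (b\<^sup>2 * (v / b))" using assms by (simp add: power2_eq_square)
    then show ?thesis using assms by (simp only: real_sqrt_mult) simp
  qed
  then have "m \<le> 2 * a / (w * b) + sqrt (v / b)"
    using m assms by (simp add: field_simps)
  moreover have "4 * a / (w * b) = 2 * (2 * a / (w * b))" by simp
  ultimately show ?thesis using 1 by argo
qed

text \<open>Testing the resolvent equation against 1 controls the sum of \<phi> over
  \<open>B\<close>, where \<open>V\<close> is at least \<open>w\<close>. Testing it against \<phi>
  controls the Dirichlet form and, by Poincare, the variance. A small variance carries the bound
  from \<open>B\<close> over to the whole cube.\<close>

lemma cube_supersolution:
  fixes V :: "(nat \<Rightarrow> real) \<Rightarrow> real" and w :: real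
  assumes n: "n \<ge> 1" and V: "\<And>x. x \<in> cube n \<Longrightarrow> 0 < V x \<and> V x \<le> 1"
    and A: "A \<subseteq> cube n" and B: "B \<subseteq> cube n" "B \<noteq> {}"
    and w: "w > 0" "\<And>x. x \<in> B \<Longrightarrow> w \<le> V x"
  defines "a \<equiv> card A / 2 ^ n" and "b \<equiv> card B / 2 ^ n"
  obtains \<phi> where
    "\<And>x. x \<in> cube n \<Longrightarrow> \<phi> x \<ge> 0" "\<And>x. x \<in> A \<Longrightarrow> \<phi> x \<ge> 1"
    "\<And>x. x \<in> cube n \<Longrightarrow> (\<Sum>i<n. \<phi> (flip i x) - \<phi> x) / n \<le> V x * \<phi> x"
    "(\<Sum>x\<in>cube n. \<phi> x) / 2 ^ n \<le> 4 * a / (w * b) + 2 * real n * a / b + 2 * real n * sqrt (a / b)"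
proof -
  let ?C = "cube n"
  obtain \<phi> where \<phi>_pos: "\<And>x. x \<in> ?C \<Longrightarrow> \<phi> x \<ge> 0"
    and \<phi>: "\<And>x. x \<in> ?C \<Longrightarrow> (1 + V x) * \<phi> x = (\<Sum>i<n. \<phi> (flip i x)) / n + 2 * indicator A x"
    using cube_resolvent_exists[of n V "\<lambda>x. 2 * indicator A x"] V n by (auto simp: indicator_def)
  have fA: "finite A" "finite B" using A B by (auto intro: finite_subset[OF _ finite_cube])
  \<comment> \<open>The factor 2 in the right-hand side of the equation offsets
    \<open>1 + V x \<le> 2\<close>.\<close>
  have ge1: "\<phi> x \<ge> 1" if "x \<in> A" for x
  proof -
    have x: "x \<in> ?C" using that A by auto
    have "2 \<le> (1 + V x) * \<phi> x"
      using \<phi>[OF x] that x \<phi>_pos by (auto intro!: divide_nonneg_nonneg sum_nonneg flip_in_cube)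
    also have "\<dots> \<le> 2 * \<phi> x" using V[OF x] \<phi>_pos[OF x] by (intro mult_right_mono) auto
    finally show ?thesis by simp
  qed
  have super: "(\<Sum>i<n. \<phi> (flip i x) - \<phi> x) / n \<le> V x * \<phi> x" if "x \<in> ?C" for x
  proof -
    have "(\<Sum>i<n. \<phi> (flip i x) - \<phi> x) / n = (\<Sum>i<n. \<phi> (flip i x)) / n - \<phi> x"
      using n by (simp add: sum_subtractf field_simps)
    also have "\<dots> = V x * \<phi> x - 2 * indicator A x" using \<phi>[OF that] by (simp add: algebra_simps)
    finally show ?thesis by simp
  qed
  have ind: "(\<Sum>x\<in>?C. indicator A x * g x) = (\<Sum>x\<in>A. g x)" for g :: "(nat \<Rightarrow> real) \<Rightarrow> real"
    using A by (simp add: indicator_def sum.If_cases Int_absorb1 if_distrib cong: if_cong)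
  define m where "m = (\<Sum>x\<in>?C. \<phi> x) / 2 ^ n"
  define W where "W = (\<Sum>x\<in>?C. (\<phi> x - m)\<^sup>2)"
  define D where "D = (\<Sum>x\<in>?C. \<Sum>i<n. (\<phi> x - \<phi> (flip i x))\<^sup>2)"
  have flip_avg: "(\<Sum>x\<in>?C. (\<Sum>i<n. g (flip i x)) / n) = (\<Sum>x\<in>?C. g x)" for g :: "(nat \<Rightarrow> real) \<Rightarrow> real"
  proof -
    have "(\<Sum>x\<in>?C. (\<Sum>i<n. g (flip i x)) / n) = (\<Sum>i<n. \<Sum>x\<in>?C. g (flip i x)) / n"
      by (subst sum.swap) (simp add: sum_divide_distrib)
    also have "\<dots> = (\<Sum>x\<in>?C. g x)" using n by (simp add: sum_flip)
    finally show ?thesis .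
  qed
  \<comment> \<open>The equation tested against 1: averaging over neighbours preserves the total
    sum, which cancels.\<close>
  have mean: "(\<Sum>x\<in>?C. V x * \<phi> x) = 2 * card A"
  proof -
    have "(\<Sum>x\<in>?C. \<phi> x) + (\<Sum>x\<in>?C. V x * \<phi> x) = (\<Sum>x\<in>?C. (1 + V x) * \<phi> x)"
      by (simp add: algebra_simps sum.distrib)
    also have "\<dots> = (\<Sum>x\<in>?C. (\<Sum>i<n. \<phi> (flip i x)) / n) + 2 * (\<Sum>x\<in>?C. indicator A x * 1)"
      by (simp add: \<phi> sum.distrib sum_distrib_left)
    also have "\<dots> = (\<Sum>x\<in>?C. \<phi> x) + 2 * card A" by (simp only: flip_avg ind) simp
    finally show ?thesis by simp
  qed
  \<comment> \<open>Test the equation for \<open>\<phi>\<close> against \<open>\<phi>\<close>; \<open>D / (2 n)\<close> is the Dirichlet form.\<close>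
  have energy: "D \<le> 4 * n * (\<Sum>x\<in>A. \<phi> x)"
  proof -
    have "D / n = (\<Sum>x\<in>?C. (\<phi> x)\<^sup>2 + (\<Sum>i<n. (\<phi> (flip i x))\<^sup>2) / n - 2 * \<phi> x * ((\<Sum>i<n. \<phi> (flip i x)) / n))"
      unfolding D_def sum_divide_distrib[of _ ?C] using n
      by (intro sum.cong refl) (simp add: power2_diff sum.distrib sum_subtractf sum_distrib_left add_divide_distrib diff_divide_distrib mult_ac)
    also have "\<dots> = (\<Sum>x\<in>?C. (\<phi> x)\<^sup>2) + (\<Sum>x\<in>?C. (\<phi> x)\<^sup>2) - (\<Sum>x\<in>?C. 2 * \<phi> x * ((\<Sum>i<n. \<phi> (flip i x)) / n))"
      by (simp add: sum.distrib sum_subtractf flip_avg[of "\<lambda>x. (\<phi> x)\<^sup>2"])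
    also have "(\<Sum>x\<in>?C. 2 * \<phi> x * ((\<Sum>i<n. \<phi> (flip i x)) / n)) =
        (\<Sum>x\<in>?C. 2 * (\<phi> x)\<^sup>2 + 2 * V x * (\<phi> x)\<^sup>2 - 4 * (indicator A x * \<phi> x))"
    proof (intro sum.cong refl)
      fix x assume "x \<in> ?C"
      then have *: "(\<Sum>i<n. \<phi> (flip i x)) / n = (1 + V x) * \<phi> x - 2 * indicator A x" by (simp add: \<phi>)
      show "2 * \<phi> x * ((\<Sum>i<n. \<phi> (flip i x)) / n) = 2 * (\<phi> x)\<^sup>2 + 2 * V x * (\<phi> x)\<^sup>2 - 4 * (indicator A x * \<phi> x)"
        unfolding * by (simp add: power2_eq_square algebra_simps)
    qed
    also have "\<dots> = 2 * (\<Sum>x\<in>?C. (\<phi> x)\<^sup>2) + (\<Sum>x\<in>?C. 2 * V x * (\<phi> x)\<^sup>2) - 4 * (\<Sum>x\<in>A. \<phi> x)"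
      unfolding ind[symmetric] by (simp only: sum.distrib sum_subtractf sum_distrib_left)
    finally have "D / n = 4 * (\<Sum>x\<in>A. \<phi> x) - (\<Sum>x\<in>?C. 2 * V x * (\<phi> x)\<^sup>2)" by linarith
    moreover have "(\<Sum>x\<in>?C. 2 * V x * (\<phi> x)\<^sup>2) \<ge> 0"
      using V by (intro sum_nonneg) (auto simp: less_imp_le)
    ultimately have "D / n \<le> 4 * (\<Sum>x\<in>A. \<phi> x)" by simp
    then show ?thesis using n by (simp add: field_simps)
  qed
  have W_eq: "W = (\<Sum>x\<in>?C. (\<phi> x)\<^sup>2) - (\<Sum>x\<in>?C. \<phi> x)\<^sup>2 / 2 ^ n"
  proof -
    have "W = (\<Sum>x\<in>?C. (\<phi> x)\<^sup>2) + 2 ^ n * m\<^sup>2 - 2 * m * (\<Sum>x\<in>?C. \<phi> x)"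
      by (simp add: W_def power2_diff sum.distrib sum_subtractf card_cube sum_distrib_left mult_ac)
    moreover have mS: "(\<Sum>x\<in>?C. \<phi> x) = 2 ^ n * m" by (simp add: m_def)
    have "2 ^ n * m\<^sup>2 = m * (\<Sum>x\<in>?C. \<phi> x)" "(\<Sum>x\<in>?C. \<phi> x)\<^sup>2 / 2 ^ n = m * (\<Sum>x\<in>?C. \<phi> x)"
      unfolding mS by (simp_all add: power2_eq_square)
    ultimately show ?thesis by simp
  qed
  \<comment> \<open>Poincare, the energy bound and the deviation estimate on \<open>A\<close>
    combine into an inequality with \<open>W\<close> on both sides.\<close>
  have "2 ^ n * W = 2 ^ n * (\<Sum>x\<in>?C. (\<phi> x)\<^sup>2) - (\<Sum>x\<in>?C. \<phi> x)\<^sup>2"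
    by (simp add: W_eq right_diff_distrib)
  also have "\<dots> \<le> 2 ^ n * (D / 4)" using cube_Poincare[of n \<phi>] by (simp add: D_def)
  finally have "W \<le> D / 4" by simp
  also have "\<dots> \<le> n * (\<Sum>x\<in>A. \<phi> x)" using energy by simp
  also have "\<dots> \<le> n * (card A * m + sqrt (card A * W))"
    using cube_sum_deviation[OF A, of \<phi> m] by (intro mult_left_mono) (auto simp: W_def)
  finally have W: "W \<le> n * (card A * m + sqrt (card A * W))" .
  have W0: "W \<ge> 0" by (simp add: W_def sum_nonneg)
  define v where "v = W / 2 ^ n"
  have sq: "sqrt (real (card E) / 2 ^ n * v) = sqrt (card E * W) / 2 ^ n" for E :: "(nat \<Rightarrow> real) set"
  proof -
    have "real (card E) / 2 ^ n * v = (card E * W) / (2 ^ n)\<^sup>2"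
      by (simp add: v_def power2_eq_square)
    then show ?thesis by (simp add: real_sqrt_divide)
  qed
  have "v \<le> n * (m * a + sqrt (a * v))"
  proof -
    have "v \<le> (n * (card A * m + sqrt (card A * W))) / 2 ^ n"
      unfolding v_def by (intro divide_right_mono W) simp
    also have "\<dots> = n * (m * a + sqrt (a * v))"
      unfolding a_def sq by (simp add: add_divide_distrib algebra_simps)
    finally show ?thesis .
  qed
  \<comment> \<open>Restricting the identity \<open>mean\<close> to \<open>B\<close> loses only
    nonnegative terms; the sum over \<open>B\<close> is then compared with
    \<open>m * card B\<close>.\<close>
  moreover have "w * (m * b - sqrt (b * v)) \<le> 2 * a"
  proof -
    have "w * (card B * m - sqrt (card B * W)) \<le> w * (\<Sum>x\<in>B. \<phi> x)"
      using cube_sum_deviation[OF B(1), of \<phi> m] w by (intro mult_left_mono) (auto simp: W_def)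
    also have "\<dots> = (\<Sum>x\<in>B. w * \<phi> x)" by (simp add: sum_distrib_left)
    also have "\<dots> \<le> (\<Sum>x\<in>B. V x * \<phi> x)"
      using w B \<phi>_pos by (intro sum_mono mult_right_mono) auto
    also have "\<dots> \<le> (\<Sum>x\<in>?C. V x * \<phi> x)"
      using B V \<phi>_pos by (intro sum_mono2) (auto simp: less_imp_le)
    finally have "w * (card B * m - sqrt (card B * W)) / 2 ^ n \<le> 2 * card A / 2 ^ n"
      unfolding mean by (rule divide_right_mono) simp
    moreover have "w * (m * b - sqrt (b * v)) = w * (card B * m - sqrt (card B * W)) / 2 ^ n"
      unfolding b_def sq by (simp add: diff_divide_distrib algebra_simps)
    ultimately show ?thesis by (simp add: a_def)
  qed
  moreover have "b > 0" using B fA by (simp add: b_def card_gt_0_iff)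
  moreover have "m \<ge> 0" using \<phi>_pos by (simp add: m_def sum_nonneg)
  ultimately have "m \<le> 4 * a / (w * b) + 2 * real n * a / b + 2 * real n * sqrt (a / b)"
    using w(1) W0 by (intro mean_le_if_variance_le[of _ _ _ v]) (auto simp: a_def v_def)
  then show thesis unfolding m_def by (intro that[of \<phi>] \<phi>_pos ge1 super)
qed


section \<open>The correlation for a fixed environment\<close>

lemma inner_prod_self: "x \<in> cube n \<Longrightarrow> inner_prod n x x = n"
proof -
  assume "x \<in> cube n"
  then have "(\<Sum>i<n. x i * x i) = (\<Sum>i<n. 1)"
    using cube_values[of x n] by (intro sum.cong) fastforce+
  then show ?thesis by (simp add: inner_prod_def)
qed

definition trap_fraction ::
    "real \<Rightarrow> (nat \<Rightarrow> (nat \<Rightarrow> real) \<Rightarrow> 'w \<Rightarrow> real) \<Rightarrow> nat \<Rightarrow> 'w \<Rightarrow> real \<Rightarrow> real" where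
  "trap_fraction \<beta> H n \<omega> K = card {x \<in> cube n. K \<le> tau \<beta> H n x \<omega>} / 2 ^ n"

text \<open>Two scenarios keep the process in place during the interval: at its start the process
  sits in a trap of depth at least \<open>K\<close>, which \<phi> controls, or it fails to leave a
  shallower vertex, at probability at most \<open>exp (- (c * s / K))\<close>. The level
  \<open>L\<close> only enters through the truncated potential.\<close>

lemma correlation_le:
  assumes mjp: "markov_jump_process N X (cube n) (jump_rate \<beta> H n \<omega>) (\<lambda>x. 1 / 2 ^ n)"
    and n: "n \<ge> 1" and pos: "c > 0" "t > 0" "s > 0" "L > 0" "K > 0" and L: "L \<le> c * t"
    and b: "trap_fraction \<beta> H n \<omega> L > 0"
  defines "a \<equiv> trap_fraction \<beta> H n \<omega> K" and "b \<equiv> trap_fraction \<beta> H n \<omega> L"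
  shows "correlation N X n c t s \<le>
    exp 1 * (4 * a * (c * t) / (L * b) + 2 * real n * a / b + 2 * real n * sqrt (a / b)) + exp (- (c * s / K))"
proof -
  let ?C = "cube n" and ?\<tau> = "\<lambda>x. tau \<beta> H n x \<omega>"
  have ne: "\<exists>x\<in>?C. L \<le> ?\<tau> x"
  proof (rule ccontr)
    assume "\<not> ?thesis"
    then have "{x \<in> ?C. L \<le> ?\<tau> x} = {}" by auto
    then show False using b by (simp only: trap_fraction_def) simp
  qed
  define T where "T = c * t"
  have T: "T > 0" using pos by (simp add: T_def)
  \<comment> \<open>\<open>V \<le> \<tau> / T\<close> gives the supersolution property, and the truncation at \<open>L \<le> T\<close> gives \<open>V \<le> 1\<close>.\<close>
  define V where "V x = min (?\<tau> x) L / T" for x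
  have \<tau>: "?\<tau> x > 0" for x by (simp add: tau_def)
  have V: "0 < V x \<and> V x \<le> 1" for x
    using T pos \<tau>[of x] L by (simp add: V_def T_def min_def field_simps)
  obtain \<phi> where \<phi>_pos: "\<And>x. x \<in> ?C \<Longrightarrow> \<phi> x \<ge> 0"
    and ge1: "\<And>x. x \<in> {x \<in> ?C. K \<le> ?\<tau> x} \<Longrightarrow> \<phi> x \<ge> 1"
    and super: "\<And>x. x \<in> ?C \<Longrightarrow> (\<Sum>i<n. \<phi> (flip i x) - \<phi> x) / n \<le> V x * \<phi> x"
    and mean: "(\<Sum>x\<in>?C. \<phi> x) / 2 ^ n \<le> 4 * a / (L / T * b) + 2 * real n * a / b + 2 * real n * sqrt (a / b)"
    unfolding a_def b_def trap_fraction_def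
    by (rule cube_supersolution[of n V "{x \<in> ?C. K \<le> ?\<tau> x}" "{x \<in> ?C. L \<le> ?\<tau> x}" "L / T"])
       (use n V T pos ne in \<open>auto simp: V_def\<close>)
  define p where "p x = measure N {w \<in> space N. X T w = x}" for x
  have p0: "p x \<ge> 0" for x by (simp add: p_def)
  have gen: "(\<Sum>z\<in>?C. generator ?C (jump_rate \<beta> H n \<omega>) x z * \<phi> z) \<le> 1 / T * \<phi> x" if x: "x \<in> ?C" for x
  proof -
    have "(\<Sum>z\<in>?C. generator ?C (jump_rate \<beta> H n \<omega>) x z * \<phi> z) = (\<Sum>i<n. \<phi> (flip i x) - \<phi> x) / n / ?\<tau> x"
      using x by (simp add: generator_sum sum_jump_rate)
    also have "\<dots> \<le> V x * \<phi> x / ?\<tau> x"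
      using super[OF x] \<tau>[of x] by (intro divide_right_mono) auto
    also have "\<dots> \<le> (?\<tau> x / T) * \<phi> x / ?\<tau> x"
      using \<tau>[of x] T \<phi>_pos[OF x] by (intro divide_right_mono mult_right_mono) (simp_all add: V_def divide_right_mono)
    also have "\<dots> = 1 / T * \<phi> x" using \<tau>[of x] by simp
    finally show ?thesis .
  qed
  have "(\<Sum>x\<in>?C. p x * \<phi> x) \<le> exp (1 / T * T) * (\<Sum>x\<in>?C. 1 / 2 ^ n * \<phi> x)"
    unfolding p_def by (rule markov_jump_process_Lyapunov[OF mjp finite_cube T _ gen]) auto
  also have "\<dots> = exp 1 * ((\<Sum>x\<in>?C. \<phi> x) / 2 ^ n)"
    using T by (simp add: sum_divide_distrib)
  also have "\<dots> \<le> exp 1 * (4 * a / (L / T * b) + 2 * real n * a / b + 2 * real n * sqrt (a / b))"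
    by (intro mult_left_mono mean) simp
  also have "4 * a / (L / T * b) = 4 * a * (c * t) / (L * b)" by (simp add: T_def)
  finally have 1: "(\<Sum>x\<in>?C. p x * \<phi> x) \<le>
    exp 1 * (4 * a * (c * t) / (L * b) + 2 * real n * a / b + 2 * real n * sqrt (a / b))" .
  \<comment> \<open>The Lyapunov bound for the constant 1 with \<kappa> = 0: the total mass does not
    exceed 1.\<close>
  have "(\<Sum>x\<in>?C. p x * 1) \<le> exp (0 * T) * (\<Sum>x\<in>?C. 1 / 2 ^ n * 1)"
    unfolding p_def
  proof (rule markov_jump_process_Lyapunov[OF mjp finite_cube T])
    show "(\<Sum>z\<in>?C. generator ?C (jump_rate \<beta> H n \<omega>) x z * 1) \<le> 0 * 1" if "x \<in> ?C" for x
      using generator_sum[OF finite_cube that, of _ "\<lambda>_. 1"] by simp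
  qed simp
  then have 2: "(\<Sum>x\<in>?C. p x) \<le> 1" by (simp add: card_cube)
  have X_in: "X u w \<in> ?C" if "u \<ge> 0" "w \<in> space N" for u w
    using mjp that measurable_space[of "X u" N "count_space ?C" w] by (auto simp: markov_jump_process_def)
  \<comment> \<open>Overlap 1 means equality of the two configurations; the factor \<open>c\<close>
    passes from the time-scale to the length of the interval.\<close>
  have "(\<forall>u. t \<le> u \<and> u < t + s \<longrightarrow> inner_prod n (X (c * t) w) (X (c * u) w) / real n = 1) \<longleftrightarrow>
      (\<forall>u. T \<le> u \<and> u < T + c * s \<longrightarrow> X u w = X T w)" if w: "w \<in> space N" for w
  proof
    assume *: "\<forall>u. t \<le> u \<and> u < t + s \<longrightarrow> inner_prod n (X (c * t) w) (X (c * u) w) / real n = 1"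
    show "\<forall>u. T \<le> u \<and> u < T + c * s \<longrightarrow> X u w = X T w"
    proof (intro allI impI)
      fix u assume u: "T \<le> u \<and> u < T + c * s"
      then have "t \<le> u / c \<and> u / c < t + s" using pos by (simp add: T_def field_simps)
      then have "inner_prod n (X T w) (X u w) / real n = 1" using * pos by (force simp: T_def)
      then show "X u w = X T w"
        using inner_prod_eq_imp_eq[OF X_in X_in n, of T w u w] w u T by simp
    qed
  next
    assume *: "\<forall>u. T \<le> u \<and> u < T + c * s \<longrightarrow> X u w = X T w"
    show "\<forall>u. t \<le> u \<and> u < t + s \<longrightarrow> inner_prod n (X (c * t) w) (X (c * u) w) / real n = 1"
    proof (intro allI impI)
      fix u assume "t \<le> u \<and> u < t + s"
      then have "T \<le> c * u \<and> c * u < T + c * s"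
        using pos by (simp add: T_def flip: distrib_left)
      then have "X (c * u) w = X T w" using * by blast
      then show "inner_prod n (X (c * t) w) (X (c * u) w) / real n = 1"
        using inner_prod_self[OF X_in[of T w]] T w n by (simp add: T_def)
    qed
  qed
  then have "correlation N X n c t s = measure N {w \<in> space N. \<forall>u. T \<le> u \<and> u < T + c * s \<longrightarrow> X u w = X T w}"
    unfolding correlation_def by (intro arg_cong[of _ _ "measure N"] Collect_cong conj_cong refl)
  also have "\<dots> \<le> (\<Sum>x\<in>?C. p x * exp (- (\<Sum>z\<in>?C - {x}. jump_rate \<beta> H n \<omega> x z) * (c * s)))"
    unfolding p_def using pos by (intro markov_jump_process_constant_le[OF mjp finite_cube T]) simp
  also have "\<dots> \<le> (\<Sum>x\<in>?C. p x * \<phi> x + p x * exp (- (c * s / K)))"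
  proof (rule sum_mono)
    fix x assume x: "x \<in> ?C"
    have "(\<Sum>z\<in>?C - {x}. jump_rate \<beta> H n \<omega> x z) = 1 / ?\<tau> x"
      using sum_jump_rate[OF x, of \<beta> H \<omega> "\<lambda>_. 1"] n by simp
    then have eq: "exp (- (\<Sum>z\<in>?C - {x}. jump_rate \<beta> H n \<omega> x z) * (c * s)) = exp (- (c * s / ?\<tau> x))" by simp
    \<comment> \<open>In a deep trap \<phi> is at least 1 and absorbs the whole probability;
      elsewhere the holding rate exceeds 1 / \<open>K\<close>.\<close>
    have "exp (- (c * s / ?\<tau> x)) \<le> \<phi> x + exp (- (c * s / K))"
    proof (cases "K \<le> ?\<tau> x")
      case True
      have "exp (- (c * s / ?\<tau> x)) \<le> 1" using pos \<tau>[of x] by simp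
      also have "1 \<le> \<phi> x" using True x by (intro ge1) simp
      finally show ?thesis by (simp add: add_increasing2)
    next
      case False
      then have "c * s / K \<le> c * s / ?\<tau> x" using pos \<tau>[of x] by (intro divide_left_mono) auto
      then show ?thesis using \<phi>_pos[OF x] by (simp add: add_increasing)
    qed
    then show "p x * exp (- (\<Sum>z\<in>?C - {x}. jump_rate \<beta> H n \<omega> x z) * (c * s)) \<le> p x * \<phi> x + p x * exp (- (c * s / K))"
      unfolding eq distrib_left[symmetric] by (rule mult_left_mono) (rule p0)
  qed
  also have "\<dots> = (\<Sum>x\<in>?C. p x * \<phi> x) + (\<Sum>x\<in>?C. p x) * exp (- (c * s / K))"
    by (simp add: sum.distrib sum_distrib_right)
  also have "\<dots> \<le> exp 1 * (4 * a * (c * t) / (L * b) + 2 * real n * a / b + 2 * real n * sqrt (a / b)) + 1 * exp (- (c * s / K))"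
    by (intro add_mono 1 mult_right_mono 2) simp
  finally show ?thesis by simp
qed


section \<open>Traps in the random environment\<close>

lemma (in prob_space) prob_eq_integral_density:
  fixes Z :: "'a \<Rightarrow> real"
  assumes "distributed M lborel Z f" "\<And>x. f x \<ge> (0::real)"
  shows "prob {\<omega> \<in> space M. u \<le> Z \<omega>} = (\<integral>x. f x * indicator {u..} x \<partial>lborel)"
proof -
  have [measurable]: "Z \<in> borel_measurable M"
    using distributed_measurable[OF assms(1)] by simp
  have "(\<integral>x. f x * indicator {u..} x \<partial>lborel) = (\<integral>\<omega>. indicator {u..} (Z \<omega>) \<partial>M)"
  proof (rule distributed_integral[OF assms(1)])
    show "(indicator {u..} :: real \<Rightarrow> real) \<in> borel_measurable lborel" by measurable
  qed (rule assms)
  also have "\<dots> = (\<integral>\<omega>. indicator {\<omega> \<in> space M. u \<le> Z \<omega>} \<omega> \<partial>M)"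
    by (intro Bochner_Integration.integral_cong) (auto simp: indicator_def)
  finally show ?thesis by simp
qed

text \<open>For \<open>x \<ge> u \<ge> 0\<close> the square of \<open>x\<close> is at least the sum
  of the squares of \<open>u\<close> and \<open>x - u\<close>, so the density is dominated by a
  multiple of the normal density centered at \<open>u\<close>, which has mass 1.\<close>

lemma (in prob_space) std_normal_tail_le:
  assumes "distributed M lborel Z std_normal_density" "u \<ge> 0"
  shows "prob {\<omega> \<in> space M. u \<le> Z \<omega>} \<le> exp (- u\<^sup>2 / 2)"
proof -
  have "(\<integral>x. std_normal_density x * indicator {u..} x \<partial>lborel) \<le>
      (\<integral>x. exp (- u\<^sup>2 / 2) * normal_density u 1 x \<partial>lborel)"
  proof (rule integral_mono')
    fix x :: real
    show "std_normal_density x * indicator {u..} x \<le> exp (- u\<^sup>2 / 2) * normal_density u 1 x"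
    proof (cases "u \<le> x")
      case True
      have "0 \<le> u * (x - u)" using True assms by simp
      moreover have "x\<^sup>2 = u\<^sup>2 + (x - u)\<^sup>2 + 2 * (u * (x - u))"
        by (simp add: power2_eq_square algebra_simps)
      ultimately have "- x\<^sup>2 / 2 \<le> - u\<^sup>2 / 2 + (- (x - u)\<^sup>2 / 2)" by linarith
      then have "exp (- x\<^sup>2 / 2) \<le> exp (- u\<^sup>2 / 2) * exp (- (x - u)\<^sup>2 / 2)"
        by (simp flip: exp_add)
      then show ?thesis using True by (simp add: normal_density_def divide_right_mono)
    qed (simp add: normal_density_nonneg)
  qed (auto intro: normal_density_nonneg)
  then show ?thesis
    using prob_eq_integral_density[OF assms(1)] by simp
qed

text \<open>On the unit interval from \<open>u\<close> to \<open>u + 1\<close> the density is at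
  least its value at the right end.\<close>

lemma (in prob_space) std_normal_tail_ge:
  assumes "distributed M lborel Z std_normal_density" "u \<ge> 0"
  shows "exp (- (u + 1)\<^sup>2 / 2) / sqrt (2 * pi) \<le> prob {\<omega> \<in> space M. u \<le> Z \<omega>}"
proof -
  have "exp (- (u + 1)\<^sup>2 / 2) / sqrt (2 * pi) =
      (\<integral>x. exp (- (u + 1)\<^sup>2 / 2) / sqrt (2 * pi) * indicator {u..u + 1} x \<partial>lborel)"
    by simp
  also have "\<dots> \<le> (\<integral>x. std_normal_density x * indicator {u..} x \<partial>lborel)"
  proof (rule integral_mono')
    show "integrable lborel (\<lambda>x. std_normal_density x * indicator {u..} x)"
      by (rule integrable_real_mult_indicator) auto
    fix x :: real
    show "exp (- (u + 1)\<^sup>2 / 2) / sqrt (2 * pi) * indicator {u..u + 1} x \<le> std_normal_density x * indicator {u..} x"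
    proof (cases "x \<in> {u..u + 1}")
      case True
      then have "x\<^sup>2 \<le> (u + 1)\<^sup>2" using assms by (intro power_mono) auto
      then show ?thesis using True by (simp add: normal_density_def divide_right_mono)
    qed simp
  qed (auto simp: indicator_def)
  also have "\<dots> = prob {\<omega> \<in> space M. u \<le> Z \<omega>}"
    using prob_eq_integral_density[OF assms(1)] by simp
  finally show ?thesis .
qed

section \<open>First and second moments of counts of events\<close>

lemma card_eq_sum_indicator:
  assumes "finite I"
  shows "real (card {i \<in> I. \<omega> \<in> A i}) = (\<Sum>i\<in>I. indicator (A i) \<omega>)"
  using assms by (simp add: indicator_def Int_def)

lemma (in prob_space) expectation_count_events:
  assumes I: "finite I" and A: "\<And>i. i \<in> I \<Longrightarrow> A i \<in> events"
  shows "integrable M (\<lambda>\<omega>. real (card {i \<in> I. \<omega> \<in> A i}))"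
    and "expectation (\<lambda>\<omega>. real (card {i \<in> I. \<omega> \<in> A i})) = (\<Sum>i\<in>I. prob (A i))"
proof -
  note eq = card_eq_sum_indicator[OF I, of _ A]
  have int: "integrable M (\<lambda>\<omega>. indicator (A i) \<omega> :: real)" if "i \<in> I" for i
    using A[OF that] by (intro integrable_real_indicator) (auto simp: emeasure_eq_measure)
  show "integrable M (\<lambda>\<omega>. real (card {i \<in> I. \<omega> \<in> A i}))"
    unfolding eq by (intro Bochner_Integration.integrable_sum int)
  have "expectation (\<lambda>\<omega>. real (card {i \<in> I. \<omega> \<in> A i})) = (\<Sum>i\<in>I. expectation (indicator (A i)))"
    unfolding eq by (intro Bochner_Integration.integral_sum int)
  also have "\<dots> = (\<Sum>i\<in>I. prob (A i))" using A by (intro sum.cong) auto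
  finally show "expectation (\<lambda>\<omega>. real (card {i \<in> I. \<omega> \<in> A i})) = (\<Sum>i\<in>I. prob (A i))" .
qed

text \<open>Second moment method: pairwise independence bounds the variance of the count by its mean
  \<open>S\<close>, and Chebyshev's inequality applies to a deviation of
  \<open>S / 2\<close>.\<close>

lemma (in prob_space) prob_few_pairwise_indep_events:
  assumes I: "finite I" and A: "\<And>i. i \<in> I \<Longrightarrow> A i \<in> events"
    and indep: "\<And>i j. i \<in> I \<Longrightarrow> j \<in> I \<Longrightarrow> i \<noteq> j \<Longrightarrow> prob (A i \<inter> A j) = prob (A i) * prob (A j)"
  defines "S \<equiv> (\<Sum>i\<in>I. prob (A i))"
  assumes S: "S > 0"
  shows "prob {\<omega> \<in> space M. card {i \<in> I. \<omega> \<in> A i} \<le> S / 2} \<le> 4 / S"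
proof -
  define Y where "Y \<omega> = real (card {i \<in> I. \<omega> \<in> A i})" for \<omega>
  have int1: "integrable M Y" and EY: "expectation Y = S"
    unfolding Y_def S_def by (rule expectation_count_events[OF I A]; assumption)+
  have [measurable]: "random_variable borel Y" using int1 by simp
  have Y2: "(Y \<omega>)\<^sup>2 = (\<Sum>i\<in>I. \<Sum>j\<in>I. indicator (A i \<inter> A j) \<omega>)" for \<omega>
    by (simp add: Y_def card_eq_sum_indicator[OF I] power2_eq_square sum_product indicator_inter_arith)
  have int: "integrable M (\<lambda>\<omega>. indicator (A i \<inter> A j) \<omega> :: real)" if "i \<in> I" "j \<in> I" for i j
    using A[OF that(1)] A[OF that(2)] by (intro integrable_real_indicator) (auto simp: emeasure_eq_measure)
  have int2: "integrable M (\<lambda>\<omega>. (Y \<omega>)\<^sup>2)"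
    unfolding Y2 by (intro Bochner_Integration.integrable_sum int)
  have "expectation (\<lambda>\<omega>. (Y \<omega>)\<^sup>2) = (\<Sum>i\<in>I. \<Sum>j\<in>I. expectation (indicator (A i \<inter> A j)))"
  proof -
    have "expectation (\<lambda>\<omega>. (Y \<omega>)\<^sup>2) = (\<Sum>i\<in>I. expectation (\<lambda>\<omega>. \<Sum>j\<in>I. indicator (A i \<inter> A j) \<omega>))"
      unfolding Y2 by (intro Bochner_Integration.integral_sum Bochner_Integration.integrable_sum int)
    also have "\<dots> = (\<Sum>i\<in>I. \<Sum>j\<in>I. expectation (indicator (A i \<inter> A j)))"
      by (intro sum.cong refl Bochner_Integration.integral_sum int)
    finally show ?thesis .
  qed
  also have "\<dots> = (\<Sum>i\<in>I. \<Sum>j\<in>I. prob (A i \<inter> A j))"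
    using A by (intro sum.cong refl) auto
  \<comment> \<open>Only the diagonal differs from the product; there the single probability is
    added as an upper bound.\<close>
  also have "\<dots> \<le> (\<Sum>i\<in>I. \<Sum>j\<in>I. prob (A i) * prob (A j) + (if i = j then prob (A i) else 0))"
    by (intro sum_mono) (auto simp: indep)
  also have "\<dots> = S\<^sup>2 + S"
    using I by (simp add: sum.distrib S_def power2_eq_square sum_product)
  finally have "variance Y \<le> S"
    using int2 by (subst variance_eq) (auto simp: EY int1)
  have "prob {\<omega> \<in> space M. card {i \<in> I. \<omega> \<in> A i} \<le> S / 2} \<le> prob {\<omega> \<in> space M. \<bar>Y \<omega> - expectation Y\<bar> \<ge> S / 2}"
  proof (rule finite_measure_mono)
    show "{\<omega> \<in> space M. \<bar>Y \<omega> - expectation Y\<bar> \<ge> S / 2} \<in> events" by measurable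
  qed (use S in \<open>auto simp: EY Y_def\<close>)
  also have "\<dots> \<le> variance Y / (S / 2)\<^sup>2"
    using S int2 by (intro Chebyshev_inequality) auto
  also have "\<dots> \<le> S / (S / 2)\<^sup>2"
    using \<open>variance Y \<le> S\<close> by (rule divide_right_mono) simp
  also have "\<dots> = 4 / S" using S by (simp add: power2_eq_square)
  finally show ?thesis .
qed

section \<open>Almost sure fractions of deep traps\<close>

lemma tau_event_eq:
  "{\<omega> \<in> space M. K \<le> tau \<beta> H n x \<omega>} = H n x -` {y. K \<le> exp (- \<beta> * y)} \<inter> space M"
  by (auto simp: tau_def)

lemma sets_tau_event:
  assumes "rem_environment M H" "n \<ge> 1" "x \<in> cube n"
  shows "{\<omega> \<in> space M. K \<le> tau \<beta> H n x \<omega>} \<in> sets M"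
proof -
  have "distributed M lborel (H n x) (normal_density 0 (sqrt (real n)))"
    using assms by (simp add: rem_environment_def)
  then have [measurable]: "H n x \<in> borel_measurable M"
    using distributed_measurable by fastforce
  show ?thesis unfolding tau_def by measurable
qed

text \<open>\<tau> exceeds \<open>K\<close> exactly when the standard normal variable
  \<open>- H n x \<omega> / sqrt n\<close> exceeds \<open>u\<close>; the condition
  \<open>K \<ge> 1\<close> makes \<open>u\<close> nonnegative.\<close>

lemma tau_tail:
  assumes env: "rem_environment M H" and n: "n \<ge> 1" and x: "x \<in> cube n" and pos: "\<beta> > 0" "K \<ge> 1"
  defines "u \<equiv> ln K / (\<beta> * sqrt n)"
  shows "measure M {\<omega> \<in> space M. K \<le> tau \<beta> H n x \<omega>} \<le> exp (- u\<^sup>2 / 2)"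
    and "exp (- (u + 1)\<^sup>2 / 2) / sqrt (2 * pi) \<le> measure M {\<omega> \<in> space M. K \<le> tau \<beta> H n x \<omega>}"
proof -
  interpret prob_space M using env by (simp add: rem_environment_def)
  have "distributed M lborel (H n x) (normal_density 0 (sqrt (real n)))"
    using env n x by (simp add: rem_environment_def)
  then have "distributed M lborel (\<lambda>\<omega>. 0 + (- 1 / sqrt n) * H n x \<omega>)
      (normal_density (0 + (- 1 / sqrt n) * 0) (\<bar>- 1 / sqrt n\<bar> * sqrt n))"
    by (rule normal_density_affine) (use n in auto)
  then have D: "distributed M lborel (\<lambda>\<omega>. - H n x \<omega> / sqrt n) std_normal_density"
    using n by simp
  have u: "u \<ge> 0" using pos n by (simp add: u_def)
  have "K \<le> tau \<beta> H n x \<omega> \<longleftrightarrow> u \<le> - H n x \<omega> / sqrt n" for \<omega>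
  proof -
    have "K \<le> tau \<beta> H n x \<omega> \<longleftrightarrow> ln K \<le> - \<beta> * H n x \<omega>"
      using pos by (simp add: tau_def ln_ge_iff[symmetric] ln_le_cancel_iff[symmetric] del: ln_le_cancel_iff)
    also have "\<dots> \<longleftrightarrow> u \<le> - H n x \<omega> / sqrt n"
      using pos n by (simp add: u_def field_simps)
    finally show ?thesis .
  qed
  then show "measure M {\<omega> \<in> space M. K \<le> tau \<beta> H n x \<omega>} \<le> exp (- u\<^sup>2 / 2)"
    and "exp (- (u + 1)\<^sup>2 / 2) / sqrt (2 * pi) \<le> measure M {\<omega> \<in> space M. K \<le> tau \<beta> H n x \<omega>}"
    using std_normal_tail_le[OF D u] std_normal_tail_ge[OF D u] by simp_all
qed

lemma trap_fraction_eq_card: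
  "\<omega> \<in> space M \<Longrightarrow> trap_fraction \<beta> H n \<omega> K =
     card {x \<in> cube n. \<omega> \<in> {\<omega> \<in> space M. K \<le> tau \<beta> H n x \<omega>}} / 2 ^ n"
  by (simp add: trap_fraction_def)

text \<open>First moment bound: the mean fraction is at most \<open>q\<close>, and Markov's
  inequality applies.\<close>

lemma prob_trap_fraction_ge:
  assumes env: "rem_environment M H" and n: "n \<ge> 1" and pos: "r > 0"
    and q: "\<And>x. x \<in> cube n \<Longrightarrow> measure M {\<omega> \<in> space M. K \<le> tau \<beta> H n x \<omega>} \<le> q"
  shows "{\<omega> \<in> space M. r \<le> trap_fraction \<beta> H n \<omega> K} \<in> sets M"
    and "measure M {\<omega> \<in> space M. r \<le> trap_fraction \<beta> H n \<omega> K} \<le> q / r"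
proof -
  interpret prob_space M using env by (simp add: rem_environment_def)
  define A where "A = (\<lambda>x. {\<omega> \<in> space M. K \<le> tau \<beta> H n x \<omega>})"
  have A: "A x \<in> events" if "x \<in> cube n" for x
    unfolding A_def by (rule sets_tau_event[OF env n that])
  define F where "F \<omega> = real (card {x \<in> cube n. \<omega> \<in> A x}) / 2 ^ n" for \<omega>
  have F0: "F \<omega> \<ge> 0" for \<omega> by (simp add: F_def)
  have F: "integrable M F" "expectation F = (\<Sum>x\<in>cube n. prob (A x)) / 2 ^ n"
    unfolding F_def using expectation_count_events[OF finite_cube A, of n] by simp_all
  have eq: "{\<omega> \<in> space M. r \<le> trap_fraction \<beta> H n \<omega> K} = {\<omega> \<in> space M. r \<le> F \<omega>}"
    using trap_fraction_eq_card[of _ M \<beta> H n K] by (auto simp: F_def A_def)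
  have [measurable]: "F \<in> borel_measurable M" using F(1) by simp
  show "{\<omega> \<in> space M. r \<le> trap_fraction \<beta> H n \<omega> K} \<in> sets M" unfolding eq by measurable
  have "(\<Sum>x\<in>cube n. prob (A x)) \<le> 2 ^ n * q"
    using sum_bounded_above[of "cube n" "\<lambda>x. prob (A x)" q] q by (simp add: A_def card_cube)
  then have "expectation F \<le> q" by (simp add: F(2) field_simps)
  moreover have "prob {\<omega> \<in> space M. r \<le> F \<omega>} \<le> expectation F / r"
    using F(1) pos F0 by (intro integral_Markov_inequality_measure[of _ _ "{}"]) auto
  ultimately show "measure M {\<omega> \<in> space M. r \<le> trap_fraction \<beta> H n \<omega> K} \<le> q / r"
    unfolding eq using pos by (meson divide_right_mono less_imp_le order_trans)
qed

text \<open>Second moment bound: the energies of distinct vertices are independent, and the mean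
  number of traps is at least \<open>2 ^ n * q\<close>.\<close>

lemma prob_trap_fraction_le:
  assumes env: "rem_environment M H" and n: "n \<ge> 1" and pos: "q > 0"
    and q: "\<And>x. x \<in> cube n \<Longrightarrow> q \<le> measure M {\<omega> \<in> space M. K \<le> tau \<beta> H n x \<omega>}"
  shows "{\<omega> \<in> space M. trap_fraction \<beta> H n \<omega> K \<le> q / 2} \<in> sets M"
    and "measure M {\<omega> \<in> space M. trap_fraction \<beta> H n \<omega> K \<le> q / 2} \<le> 4 / (2 ^ n * q)"
proof -
  interpret prob_space M using env by (simp add: rem_environment_def)
  define A where "A = (\<lambda>x. {\<omega> \<in> space M. K \<le> tau \<beta> H n x \<omega>})"
  have A: "A x \<in> events" if "x \<in> cube n" for x
    unfolding A_def by (rule sets_tau_event[OF env n that])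
  have indep: "prob (A x \<inter> A y) = prob (A x) * prob (A y)" if "x \<in> cube n" "y \<in> cube n" "x \<noteq> y" for x y
  proof -
    have iv: "indep_vars (\<lambda>_. borel) (H n) (cube n)" using env n by (simp add: rem_environment_def)
    have S: "{y. K \<le> exp (- \<beta> * y)} \<in> sets borel" by measurable
    have "prob (\<Inter>j\<in>{x, y}. H n j -` {y. K \<le> exp (- \<beta> * y)} \<inter> space M) =
        (\<Prod>j\<in>{x, y}. prob (H n j -` {y. K \<le> exp (- \<beta> * y)} \<inter> space M))"
      by (rule indep_varsD[OF iv]) (use that S in auto)
    then show ?thesis using that by (simp add: A_def tau_event_eq)
  qed
  define S where "S = (\<Sum>x\<in>cube n. prob (A x))"
  have "2 ^ n * q \<le> S"
    using sum_bounded_below[of "cube n" q "\<lambda>x. prob (A x)"] q by (simp add: A_def S_def card_cube)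
  moreover have "0 < 2 ^ n * q" using pos by simp
  ultimately have S: "0 < 2 ^ n * q" "2 ^ n * q \<le> S" "S > 0" by linarith+
  define F where "F \<omega> = real (card {x \<in> cube n. \<omega> \<in> A x})" for \<omega>
  have "integrable M F"
    unfolding F_def using expectation_count_events[OF finite_cube A, of n] by simp
  then have [measurable]: "F \<in> borel_measurable M" by simp
  have eq: "{\<omega> \<in> space M. trap_fraction \<beta> H n \<omega> K \<le> q / 2} = {\<omega> \<in> space M. F \<omega> \<le> 2 ^ n * q / 2}"
  proof (intro Collect_cong conj_cong refl)
    fix \<omega> assume "\<omega> \<in> space M"
    then have *: "trap_fraction \<beta> H n \<omega> K = F \<omega> / 2 ^ n"
      using trap_fraction_eq_card[of \<omega> M \<beta> H n K] by (simp add: F_def A_def)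
    show "trap_fraction \<beta> H n \<omega> K \<le> q / 2 \<longleftrightarrow> F \<omega> \<le> 2 ^ n * q / 2"
      unfolding * by (simp add: field_simps)
  qed
  show "{\<omega> \<in> space M. trap_fraction \<beta> H n \<omega> K \<le> q / 2} \<in> sets M" unfolding eq by measurable
  have "measure M {\<omega> \<in> space M. F \<omega> \<le> 2 ^ n * q / 2} \<le> measure M {\<omega> \<in> space M. F \<omega> \<le> S / 2}"
  proof (rule finite_measure_mono)
    show "{\<omega> \<in> space M. F \<omega> \<le> S / 2} \<in> events" by measurable
  qed (use S in auto)
  also have "\<dots> \<le> 4 / S"
    unfolding F_def S_def
    by (rule prob_few_pairwise_indep_events[OF finite_cube A indep]) (use S in \<open>auto simp: S_def\<close>)
  also have "\<dots> \<le> 4 / (2 ^ n * q)" using S by (intro divide_left_mono) auto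
  finally show "measure M {\<omega> \<in> space M. trap_fraction \<beta> H n \<omega> K \<le> q / 2} \<le> 4 / (2 ^ n * q)"
    unfolding eq .
qed

text \<open>Borel-Cantelli: exceeding the mean bound by the factor \<open>n\<^sup>2\<close> has
  summable probability. The first Borel-Cantelli lemma allows any dependence between environments of
  different size.\<close>

lemma AE_trap_fraction_le:
  assumes env: "rem_environment M H" and \<beta>: "\<beta> > 0" and K: "\<forall>\<^sub>F n in sequentially. K n \<ge> 1"
  shows "AE \<omega> in M. \<forall>\<^sub>F n in sequentially. trap_fraction \<beta> H n \<omega> (K n) \<le>
    (real n)\<^sup>2 * exp (- (ln (K n) / (\<beta> * sqrt n))\<^sup>2 / 2)"
proof -
  interpret prob_space M using env by (simp add: rem_environment_def)
  define r where "r n = (real n)\<^sup>2 * exp (- (ln (K n) / (\<beta> * sqrt n))\<^sup>2 / 2)" for n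
  \<comment> \<open>The bound on \<open>K\<close> holds only eventually; the empty event elsewhere
    keeps the estimate valid for every \<open>n\<close>.\<close>
  define E where "E n = (if n \<ge> 1 \<and> K n \<ge> 1 then {\<omega> \<in> space M. r n \<le> trap_fraction \<beta> H n \<omega> (K n)} else {})" for n
  have E: "E n \<in> events" "prob (E n) \<le> inverse (real n ^ 2)" for n
  proof -
    have "E n \<in> events \<and> prob (E n) \<le> inverse (real n ^ 2)"
    proof (cases "n \<ge> 1 \<and> K n \<ge> 1")
      case True
      then have n: "n \<ge> 1" "r n > 0" by (auto simp: r_def)
      define q where "q = exp (- (ln (K n) / (\<beta> * sqrt n))\<^sup>2 / 2)"
      have q: "prob {\<omega> \<in> space M. K n \<le> tau \<beta> H n x \<omega>} \<le> q" if "x \<in> cube n" for x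
        unfolding q_def by (rule tau_tail(1)[OF env n(1) that \<beta>]) (use True in simp)
      have "q / r n = inverse (real n ^ 2)"
        by (simp add: q_def r_def inverse_eq_divide)
      then show ?thesis
        using prob_trap_fraction_ge[OF env n(1) n(2) q] True by (simp add: E_def)
    qed (auto simp: E_def)
    then show "E n \<in> events" "prob (E n) \<le> inverse (real n ^ 2)" by auto
  qed
  have "AE \<omega> in M. \<forall>\<^sub>F n in sequentially. \<omega> \<in> space M - E n"
  proof (rule borel_cantelli_AE1)
    have "summable (\<lambda>n. inverse (real n ^ 2))" by (rule inverse_power_summable) simp
    then show "summable (\<lambda>n. prob (E n))" by (rule summable_comparison_test') (use E in auto)
  qed (use E in \<open>auto simp: emeasure_eq_measure\<close>)
  then show ?thesis
  proof eventually_elim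
    case (elim \<omega>)
    have "\<forall>\<^sub>F n in sequentially. n \<ge> (1::nat)" by (rule eventually_ge_at_top)
    with elim K show ?case
      by eventually_elim (auto simp: E_def r_def split: if_splits)
  qed
qed

text \<open>At this level the standardized threshold is \<open>\<beta> * sqrt n\<close>, so the mean
  number of traps grows like \<open>2 ^ n * exp (- \<beta>\<^sup>2 * n / 2)\<close> up to
  subexponential factors. This is exponentially large by the assumption on \<beta>, and the
  Chebyshev bounds are summable.\<close>

lemma AE_trap_fraction_ge:
  fixes \<beta> :: real
  assumes env: "rem_environment M H" and \<beta>: "\<beta> > 0" "\<beta>\<^sup>2 / 2 < ln 2"
  shows "AE \<omega> in M. \<forall>\<^sub>F n in sequentially.
    exp (- (\<beta> * sqrt n + 1)\<^sup>2 / 2) / (2 * sqrt (2 * pi)) \<le> trap_fraction \<beta> H n \<omega> (exp (\<beta>\<^sup>2 * n))"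
proof -
  interpret prob_space M using env by (simp add: rem_environment_def)
  define q where "q n = exp (- (\<beta> * sqrt n + 1)\<^sup>2 / 2) / sqrt (2 * pi)" for n :: nat
  define E where "E n = (if n \<ge> 1 then {\<omega> \<in> space M. trap_fraction \<beta> H n \<omega> (exp (\<beta>\<^sup>2 * n)) \<le> q n / 2} else {})" for n :: nat
  have E: "E n \<in> events" "prob (E n) \<le> 4 / (2 ^ n * q n)" for n
  proof -
    have q: "q n > 0" by (simp add: q_def)
    have "E n \<in> events \<and> prob (E n) \<le> 4 / (2 ^ n * q n)"
    proof (cases "n \<ge> 1")
      case True
      have "ln (exp (\<beta>\<^sup>2 * n)) / (\<beta> * sqrt n) = \<beta> * sqrt n"
        using True \<beta> by (simp add: field_simps power2_eq_square flip: real_sqrt_mult)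
      then have "q n \<le> prob {\<omega> \<in> space M. exp (\<beta>\<^sup>2 * n) \<le> tau \<beta> H n x \<omega>}" if "x \<in> cube n" for x
        using tau_tail(2)[OF env True that, where \<beta> = \<beta> and K = "exp (\<beta>\<^sup>2 * n)"] \<beta> by (simp add: q_def)
      then show ?thesis
        using prob_trap_fraction_le[OF env True q] True by (simp add: E_def)
    qed (use q in \<open>auto simp: E_def intro!: divide_nonneg_nonneg\<close>)
    then show "E n \<in> events" "prob (E n) \<le> 4 / (2 ^ n * q n)" by auto
  qed
  \<comment> \<open>The exponential growth rate of the expected number of traps.\<close>
  define d where "d = ln 2 - \<beta>\<^sup>2 / 2"
  have d: "d > 0" using \<beta> by (simp add: d_def)
  have q_eq: "4 / (2 ^ n * q n) = 4 * sqrt (2 * pi) * exp (- d * n + \<beta> * sqrt n + 1 / 2)" for n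
  proof -
    have "(2::real) ^ n = exp (n * ln 2)" by (simp add: exp_of_nat_mult)
    moreover have "(\<beta> * sqrt n + 1)\<^sup>2 / 2 - n * ln 2 = - d * n + \<beta> * sqrt n + 1 / 2"
      by (simp add: d_def power2_sum power_mult_distrib field_simps)
    moreover have "4 / (exp x * (exp (- y / 2) / s)) = 4 * s * exp (y / 2 - x)" for x y s :: real
    proof -
      have e: "exp (- y / 2) = 1 / exp (y / 2)" by (simp add: exp_minus inverse_eq_divide)
      show ?thesis unfolding e exp_diff by simp
    qed
    ultimately show ?thesis by (simp only: q_def)
  qed
  have "AE \<omega> in M. \<forall>\<^sub>F n in sequentially. \<omega> \<in> space M - E n"
  proof (rule borel_cantelli_AE1)
    have "(\<lambda>n::nat. 4 * sqrt (2 * pi) * exp (- d * n + \<beta> * sqrt n + 1 / 2)) \<in> O(\<lambda>n. inverse (real n ^ 2))"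
      using d by real_asymp
    moreover have "summable (\<lambda>n. norm (inverse (real n ^ 2)))"
      using inverse_power_summable[of 2, where 'a = real] by simp
    ultimately have "summable (\<lambda>n. 4 / (2 ^ n * q n))"
      unfolding q_eq by (rule summable_comparison_test_bigo[rotated])
    then show "summable (\<lambda>n. prob (E n))" by (rule summable_comparison_test') (use E in auto)
  qed (use E in \<open>auto simp: emeasure_eq_measure\<close>)
  then show ?thesis
  proof eventually_elim
    case (elim \<omega>)
    have "\<forall>\<^sub>F n in sequentially. n \<ge> (1::nat)" by (rule eventually_ge_at_top)
    with elim show ?case
      by eventually_elim (auto simp: E_def q_def split: if_splits)
  qed
qed


section \<open>Asymptotics\<close>

lemma exp_mult_tendsto_0:
  assumes "k \<longlonglongrightarrow> l" "l < (0::real)"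
  shows "(\<lambda>n. exp (real n * k n)) \<longlonglongrightarrow> 0"
proof -
  have "filterlim (\<lambda>n. k n * real n) at_bot sequentially"
    by (rule filterlim_tendsto_neg_mult_at_bot[OF assms filterlim_real_sequentially])
  then show ?thesis
    using filterlim_compose[OF exp_at_bot] by (simp add: mult.commute)
qed

text \<open>By definition \<open>a n\<close> is the inverse of the tail probability of \<tau> at
  \<open>c n\<close>. The two Gaussian tail bounds translate the exponential growth of
  \<open>a\<close> into that of \<open>c\<close>.\<close>

lemma ln_time_scale_tendsto:
  assumes env: "rem_environment M H" and \<beta>: "\<beta> > 0"
    and scale: "intermediate_time_scale M H \<beta> \<epsilon> c a"
  shows "(\<lambda>n. ln (c n) / n) \<longlonglongrightarrow> \<beta> * beta_c \<epsilon>"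
proof -
  have c: "filterlim c at_top sequentially"
    and a: "\<And>n x. n \<ge> 1 \<Longrightarrow> x \<in> cube n \<Longrightarrow> a n * measure M {\<omega> \<in> space M. tau \<beta> H n x \<omega> \<ge> c n} = 1"
    and a_lim: "(\<lambda>n. ln (a n) / (real n * ln 2)) \<longlonglongrightarrow> \<epsilon>"
    using scale by (auto simp: intermediate_time_scale_def)
  \<comment> \<open>Scaled so that \<open>v n * sqrt n\<close> is the standard normal threshold
    corresponding to \<open>c n\<close>.\<close>
  define v where "v n = ln (c n) / (\<beta> * n)" for n :: nat
  define l where "l n = ln (a n) / n" for n :: nat
  define C where "C = ln (sqrt (2 * pi))"
  have l: "l \<longlonglongrightarrow> \<epsilon> * ln 2"
  proof -
    have "(\<lambda>n. ln (a n) / (real n * ln 2) * ln 2) \<longlonglongrightarrow> \<epsilon> * ln 2"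
      by (intro tendsto_intros a_lim)
    then show ?thesis by (simp add: l_def[abs_def])
  qed
  \<comment> \<open>The upper tail bound limits \<open>v\<close> from above; the lower one limits it
    from below, with the shift \<open>1 / sqrt n\<close> and the constant \<open>C\<close> as
    vanishing corrections.\<close>
  have bounds: "\<forall>\<^sub>F n in sequentially. v n \<le> sqrt (2 * l n) \<and> sqrt (2 * l n - 2 * C / n) - 1 / sqrt n \<le> v n"
  proof -
    have "\<forall>\<^sub>F n in sequentially. c n \<ge> 1" using c by (simp add: filterlim_at_top)
    moreover have "\<forall>\<^sub>F n in sequentially. n \<ge> (1::nat)" by (rule eventually_ge_at_top)
    ultimately show ?thesis
    proof eventually_elim
      case (elim n)
      obtain x where x: "x \<in> cube n" using cube_nonempty[of n] by auto
      define P where "P = measure M {\<omega> \<in> space M. c n \<le> tau \<beta> H n x \<omega>}"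
      have aP: "a n * P = 1" using a[of n x] elim x by (simp add: P_def)
      moreover have "P \<ge> 0" by (simp add: P_def)
      ultimately have P: "P > 0" by (cases "P = 0") auto
      then have "a n = 1 / P" using aP by (simp add: field_simps)
      then have ln_a: "ln (a n) = - ln P" using P by (simp add: ln_div)
      have n: "real n > 0" using elim by simp
      have u: "ln (c n) / (\<beta> * sqrt n) = v n * sqrt n"
        using \<beta> n by (simp add: v_def field_simps)
      have v0: "v n \<ge> 0" using elim \<beta> by (simp add: v_def)
      have "ln P \<le> ln (exp (- (v n * sqrt n)\<^sup>2 / 2))"
        using tau_tail(1)[OF env elim(2) x \<beta> elim(1)] P by (simp only: u ln_le_cancel_iff P_def exp_gt_zero)
      then have "(v n)\<^sup>2 * n \<le> 2 * ln (a n)" using n by (simp add: ln_a power_mult_distrib)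
      then have "(v n)\<^sup>2 \<le> 2 * l n" using n by (simp add: l_def field_simps)
      then have 1: "v n \<le> sqrt (2 * l n)" by (rule real_le_rsqrt)
      have "ln (exp (- (v n * sqrt n + 1)\<^sup>2 / 2) / sqrt (2 * pi)) \<le> ln P"
        using tau_tail(2)[OF env elim(2) x \<beta> elim(1)] P by (simp only: u ln_le_cancel_iff P_def) simp
      then have "2 * ln (a n) - 2 * C \<le> (v n * sqrt n + 1)\<^sup>2"
        by (simp add: ln_div C_def ln_a)
      also have "\<dots> = n * (v n + 1 / sqrt n)\<^sup>2"
      proof -
        have "v n * sqrt n + 1 = sqrt n * (v n + 1 / sqrt n)" using n by (simp add: field_simps)
        then show ?thesis using n by (simp add: power_mult_distrib)
      qed
      finally have "(2 * ln (a n) - 2 * C) / n \<le> (v n + 1 / sqrt n)\<^sup>2"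
        using n by (simp add: pos_divide_le_eq mult.commute)
      then have "2 * l n - 2 * C / n \<le> (v n + 1 / sqrt n)\<^sup>2"
        by (simp add: l_def diff_divide_distrib)
      then have "sqrt (2 * l n - 2 * C / n) \<le> v n + 1 / sqrt n"
        using v0 n by (intro real_le_lsqrt) auto
      with 1 show ?case by simp
    qed
  qed
  have lim1: "(\<lambda>n. sqrt (2 * l n)) \<longlonglongrightarrow> beta_c \<epsilon>"
    unfolding beta_c_def using l by (auto intro!: tendsto_eq_intros)
  have sq: "(\<lambda>n. 1 / sqrt (real n)) \<longlonglongrightarrow> 0" by real_asymp
  have C: "(\<lambda>n. 2 * C / real n) \<longlonglongrightarrow> 0" by real_asymp
  have "(\<lambda>n. sqrt (2 * l n - 2 * C / n) - 1 / sqrt n) \<longlonglongrightarrow> sqrt (2 * (\<epsilon> * ln 2) - 0) - 0"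
    by (intro tendsto_diff tendsto_real_sqrt tendsto_mult tendsto_const l sq C)
  then have lim2: "(\<lambda>n. sqrt (2 * l n - 2 * C / n) - 1 / sqrt n) \<longlonglongrightarrow> beta_c \<epsilon>"
    by (simp add: beta_c_def mult.assoc)
  have "v \<longlonglongrightarrow> beta_c \<epsilon>"
    by (rule tendsto_sandwich[OF _ _ lim2 lim1]; rule eventually_mono[OF bounds]) auto
  then have "(\<lambda>n. \<beta> * v n) \<longlonglongrightarrow> \<beta> * beta_c \<epsilon>" by (intro tendsto_intros)
  then show ?thesis using \<beta> by (simp add: v_def)
qed

text \<open>The deterministic part, for a fixed environment with the typical trap fractions and with
  \<gamma> in the role of the critical value. Trap depth \<open>K = c n / n\<close> makes the escape
  term \<open>exp (- (n * s))\<close>.\<close>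

lemma correlation_tendsto_0:
  fixes \<beta> \<gamma> s t :: real and c :: "nat \<Rightarrow> real"
  assumes mjp: "\<And>n. n \<ge> 1 \<Longrightarrow>
      markov_jump_process (N n) (X n) (cube n) (jump_rate \<beta> H n \<omega>) (\<lambda>x. 1 / 2 ^ n)"
    and \<beta>: "0 < \<beta>" "\<beta> < \<gamma>" and pos: "t > 0" "s > 0"
    and c: "filterlim c at_top sequentially" and y: "(\<lambda>n. ln (c n) / n) \<longlonglongrightarrow> \<beta> * \<gamma>"
    and upper: "\<forall>\<^sub>F n in sequentially. trap_fraction \<beta> H n \<omega> (c n / n) \<le>
        (real n)\<^sup>2 * exp (- (ln (c n / n) / (\<beta> * sqrt n))\<^sup>2 / 2)"
    and lower: "\<forall>\<^sub>F n in sequentially.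
        exp (- (\<beta> * sqrt n + 1)\<^sup>2 / 2) / (2 * sqrt (2 * pi)) \<le> trap_fraction \<beta> H n \<omega> (exp (\<beta>\<^sup>2 * n))"
  shows "(\<lambda>n. correlation (N n) (X n) n (c n) t s) \<longlonglongrightarrow> 0"
proof -
  define C where "C = 2 * sqrt (2 * pi)"
  have C: "C > 0" by (simp add: C_def)
  \<comment> \<open>The exponential rate of \<open>c n / n\<close>.\<close>
  define z where "z n = ln (c n) / n - ln n / n" for n :: nat
  \<comment> \<open>The rate of the bound on \<open>\<alpha> * c n / (L * b)\<close>: the factor
    \<open>n\<^sup>2\<close>, the Gaussian tail at \<open>c n / n\<close>, \<open>c n\<close>
    itself, the inverse of \<open>b\<close>, and the inverse of \<open>L\<close>.\<close>
  define k1 where "k1 n = 2 * (ln n / n) - (z n)\<^sup>2 / (2 * \<beta>\<^sup>2) + ln (c n) / n + (\<beta> + 1 / sqrt n)\<^sup>2 / 2 - \<beta>\<^sup>2" for n :: nat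
  \<comment> \<open>The rate of \<open>n\<^sup>2 * \<alpha> / b\<close>. The coefficient 4 joins
    this \<open>n\<^sup>2\<close> with the one in the bound on \<alpha>; the product dominates both
    remaining terms of \<open>correlation_le\<close>.\<close>
  define k2 where "k2 n = 4 * (ln n / n) - (z n)\<^sup>2 / (2 * \<beta>\<^sup>2) + (\<beta> + 1 / sqrt n)\<^sup>2 / 2" for n :: nat
  have lnn: "(\<lambda>n. ln (real n) / real n) \<longlonglongrightarrow> 0" by real_asymp
  have sq: "(\<lambda>n. 1 / sqrt (real n)) \<longlonglongrightarrow> 0" by real_asymp
  have z: "z \<longlonglongrightarrow> \<beta> * \<gamma>"
    unfolding z_def using tendsto_diff[OF y lnn] by simp
  have "k1 \<longlonglongrightarrow> 2 * 0 - (\<beta> * \<gamma>)\<^sup>2 / (2 * \<beta>\<^sup>2) + \<beta> * \<gamma> + (\<beta> + 0)\<^sup>2 / 2 - \<beta>\<^sup>2"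
    unfolding k1_def using \<beta> by (intro tendsto_intros lnn sq z y) auto
  also have "2 * 0 - (\<beta> * \<gamma>)\<^sup>2 / (2 * \<beta>\<^sup>2) + \<beta> * \<gamma> + (\<beta> + 0)\<^sup>2 / 2 - \<beta>\<^sup>2 = - (\<gamma> - \<beta>)\<^sup>2 / 2"
    using \<beta> by (simp add: power_mult_distrib) (simp add: power2_eq_square field_simps)
  finally have k1: "(\<lambda>n. exp (real n * k1 n)) \<longlonglongrightarrow> 0"
    by (rule exp_mult_tendsto_0) (use \<beta> in simp)
  have "k2 \<longlonglongrightarrow> 4 * 0 - (\<beta> * \<gamma>)\<^sup>2 / (2 * \<beta>\<^sup>2) + (\<beta> + 0)\<^sup>2 / 2"
    unfolding k2_def using \<beta> by (intro tendsto_intros lnn sq z y) auto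
  also have "4 * 0 - (\<beta> * \<gamma>)\<^sup>2 / (2 * \<beta>\<^sup>2) + (\<beta> + 0)\<^sup>2 / 2 = (\<beta>\<^sup>2 - \<gamma>\<^sup>2) / 2"
    using \<beta> by (simp add: power_mult_distrib field_simps)
  finally have k2: "(\<lambda>n. exp (real n * k2 n)) \<longlonglongrightarrow> 0"
    by (rule exp_mult_tendsto_0) (use \<beta> power_strict_mono[of \<beta> \<gamma> 2] in simp)
  define R where "R n = exp 1 * (4 * (C * t * exp (n * k1 n)) + 2 * (C * exp (n * k2 n)) +
      2 * sqrt (C * exp (n * k2 n))) + exp (- (n * s))" for n :: nat
  have ev_pos: "\<forall>\<^sub>F n in sequentially. z n > 0"
    using \<beta> by (intro order_tendstoD(1)[OF z]) simp
  have "(\<lambda>n. ln t / real n) \<longlonglongrightarrow> 0" by real_asymp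
  then have "(\<lambda>n. ln (c n) / n + ln t / n) \<longlonglongrightarrow> \<beta> * \<gamma> + 0" by (intro tendsto_intros y)
  \<comment> \<open>As \<beta> < \<gamma>, the level \<open>exp (\<beta>\<^sup>2 * n)\<close>
    eventually lies below \<open>c n * t\<close>, as the truncation in \<open>correlation_le\<close>
    demands.\<close>
  then have ev_L: "\<forall>\<^sub>F n in sequentially. \<beta>\<^sup>2 < ln (c n) / n + ln t / n"
    by (rule order_tendstoD(1)) (use \<beta> in \<open>simp add: power2_eq_square\<close>)
  have ev_c: "\<forall>\<^sub>F n in sequentially. c n \<ge> 1" using c by (simp add: filterlim_at_top)
  have "\<forall>\<^sub>F n in sequentially. n \<ge> (1::nat)" by (rule eventually_ge_at_top)
  with ev_c ev_L upper lower have le: "\<forall>\<^sub>F n in sequentially. correlation (N n) (X n) n (c n) t s \<le> R n"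
  proof eventually_elim
    case (elim n)
    define L where "L = exp (\<beta>\<^sup>2 * n)"
    define \<alpha> where "\<alpha> = trap_fraction \<beta> H n \<omega> (c n / n)"
    define b where "b = trap_fraction \<beta> H n \<omega> L"
    define A where "A = (real n)\<^sup>2 * exp (- (ln (c n / n) / (\<beta> * sqrt n))\<^sup>2 / 2)"
    define B where "B = exp (- (\<beta> * sqrt n + 1)\<^sup>2 / 2) / C"
    have n: "real n > 0" and n1: "real n \<ge> 1" using elim by auto
    have cn: "c n > 0" using elim by simp
    have \<alpha>A: "\<alpha> \<le> A" "\<alpha> \<ge> 0" using elim by (auto simp: \<alpha>_def A_def trap_fraction_def)
    have B: "B > 0" "B \<le> b" using elim C by (auto simp: B_def b_def L_def C_def)
    have b: "b > 0" using B by linarith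
    have L: "L \<le> c n * t"
    proof -
      have "\<beta>\<^sup>2 * n \<le> ln (c n) + ln t" using elim n by (simp add: field_simps)
      also have "\<dots> = ln (c n * t)" using cn pos by (simp add: ln_mult)
      finally show ?thesis unfolding L_def using cn pos by (subst ln_ge_iff[symmetric]) auto
    qed
    have "ln (c n / n) = n * z n"
      using n cn by (simp add: z_def ln_div field_simps)
    moreover have "(real n * z n / (\<beta> * sqrt n))\<^sup>2 / 2 = n * ((z n)\<^sup>2 / (2 * \<beta>\<^sup>2))"
      using n \<beta> by (simp add: power_divide power_mult_distrib) (simp add: power2_eq_square)
    moreover have n2: "(real n) ^ k = exp (n * (k * (ln n / n)))" for k
      using n by (simp add: exp_of_nat_mult)
    ultimately have A: "A = exp (n * (2 * (ln n / n) - (z n)\<^sup>2 / (2 * \<beta>\<^sup>2)))"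
      by (simp add: A_def algebra_simps flip: exp_add)
    have "\<beta> * sqrt n + 1 = sqrt n * (\<beta> + 1 / sqrt n)" using n by (simp add: field_simps)
    then have "(\<beta> * sqrt n + 1)\<^sup>2 / 2 = n * ((\<beta> + 1 / sqrt n)\<^sup>2 / 2)"
      using n by (simp add: power_mult_distrib)
    then have invB: "1 / B = C * exp (n * ((\<beta> + 1 / sqrt n)\<^sup>2 / 2))"
      by (simp add: B_def exp_minus field_simps)
    have ab: "\<alpha> / b \<le> A * (1 / B)"
      using \<alpha>A B by (simp add: frac_le)
    have e1: "A * (1 / B) * (c n / L) = C * exp (n * k1 n)"
    proof -
      have "c n = exp (n * (ln (c n) / n))" using n cn by simp
      then have "c n / L = exp (n * (ln (c n) / n) - n * \<beta>\<^sup>2)"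
        by (simp add: L_def exp_diff mult.commute)
      then show ?thesis
        unfolding A invB k1_def by (simp add: algebra_simps flip: exp_add)
    qed
    have "\<alpha> / b * (c n / L) * t \<le> A * (1 / B) * (c n / L) * t"
      using ab cn pos by (intro mult_right_mono) (auto simp: L_def)
    then have t1: "\<alpha> * (c n * t) / (L * b) \<le> C * t * exp (n * k1 n)"
      unfolding e1 by (simp add: mult_ac)
    have e2: "(real n)\<^sup>2 * (A * (1 / B)) = C * exp (n * k2 n)"
      unfolding A invB k2_def n2 by (simp add: algebra_simps flip: exp_add)
    have t2: "(real n)\<^sup>2 * (\<alpha> / b) \<le> C * exp (n * k2 n)"
      unfolding e2[symmetric] using ab by (rule mult_left_mono) simp
    have t3: "real n * (\<alpha> / b) \<le> C * exp (n * k2 n)"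
    proof -
      have "real n * (\<alpha> / b) \<le> (real n)\<^sup>2 * (\<alpha> / b)"
        using n1 \<alpha>A b by (intro mult_right_mono) (auto simp: power2_eq_square)
      then show ?thesis using t2 by linarith
    qed
    \<comment> \<open>The additional factor \<open>n\<^sup>2\<close> in \<open>k2\<close> is what
      pulls \<open>n\<close> under the square root.\<close>
    have t4: "real n * sqrt (\<alpha> / b) \<le> sqrt (C * exp (n * k2 n))"
    proof -
      have "real n * sqrt (\<alpha> / b) = sqrt ((real n)\<^sup>2 * (\<alpha> / b))" unfolding real_sqrt_mult by simp
      then show ?thesis using t2 by simp
    qed
    have "correlation (N n) (X n) n (c n) t s \<le>
      exp 1 * (4 * \<alpha> * (c n * t) / (L * b) + 2 * real n * \<alpha> / b + 2 * real n * sqrt (\<alpha> / b)) + exp (- (c n * s / (c n / n)))"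
      unfolding \<alpha>_def b_def
      by (rule correlation_le[OF mjp]) (use elim cn pos n L b in \<open>auto simp: b_def L_def\<close>)
    also have "\<dots> = exp 1 * (4 * (\<alpha> * (c n * t) / (L * b)) + 2 * (real n * (\<alpha> / b)) + 2 * (real n * sqrt (\<alpha> / b))) + exp (- (n * s))"
      using cn by (simp add: mult_ac)
    also have "\<dots> \<le> R n"
      unfolding R_def using t1 t3 t4 by (intro add_mono mult_left_mono) auto
    finally show ?case .
  qed
  have "(\<lambda>n. exp (- (real n * s))) \<longlonglongrightarrow> 0" using pos by real_asymp
  then have "R \<longlonglongrightarrow> exp 1 * (4 * (C * t * 0) + 2 * (C * 0) + 2 * sqrt (C * 0)) + 0"
    unfolding R_def by (intro tendsto_intros k1 k2)
  then have R: "R \<longlonglongrightarrow> 0" by simp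
  show ?thesis
    by (rule tendsto_sandwich[OF _ le tendsto_const R]) (simp add: correlation_def)
qed

theorem theorem1p4:
  fixes M :: "'w measure"
    and H :: "nat \<Rightarrow> (nat \<Rightarrow> real) \<Rightarrow> 'w \<Rightarrow> real"
    and N :: "'w \<Rightarrow> nat \<Rightarrow> 'b measure"
    and X :: "'w \<Rightarrow> nat \<Rightarrow> real \<Rightarrow> 'b \<Rightarrow> nat \<Rightarrow> real"
    and \<beta> \<epsilon> :: real
    and c a :: "nat \<Rightarrow> real"
  assumes "rem_environment M H"
    and "\<And>\<omega> n. \<omega> \<in> space M \<Longrightarrow> n \<ge> 1 \<Longrightarrow>
           markov_jump_process (N \<omega> n) (X \<omega> n) (cube n) (jump_rate \<beta> H n \<omega>) (\<lambda>x. 1 / 2 ^ n)"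
    and "0 < \<epsilon>" and "\<epsilon> \<le> 1"
    and "0 < \<beta>" and "\<beta> < beta_c \<epsilon>"
    and "intermediate_time_scale M H \<beta> \<epsilon> c a"
  shows "AE \<omega> in M. \<forall>t>0. \<forall>s>0.
           (\<lambda>n. correlation (N \<omega> n) (X \<omega> n) n (c n) t s) \<longlonglongrightarrow> 0"
proof -
  have c: "filterlim c at_top sequentially"
    using assms(7) by (simp add: intermediate_time_scale_def)
  have y: "(\<lambda>n. ln (c n) / n) \<longlonglongrightarrow> \<beta> * beta_c \<epsilon>"
    by (rule ln_time_scale_tendsto[OF assms(1,5,7)])
  \<comment> \<open>\<open>c n\<close> grows exponentially, so dividing it by \<open>n\<close>
    leaves it above 1 in the end.\<close>
  have "\<forall>\<^sub>F n in sequentially. c n / n \<ge> 1"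
  proof -
    have "(\<lambda>n. ln (real n) / real n) \<longlonglongrightarrow> 0" by real_asymp
    then have "(\<lambda>n. ln (c n) / n - ln n / n) \<longlonglongrightarrow> \<beta> * beta_c \<epsilon> - 0"
      by (intro tendsto_diff y)
    then have "\<forall>\<^sub>F n in sequentially. ln (c n) / n - ln n / n > 0"
      by (rule order_tendstoD(1)) (use assms in simp)
    moreover have "\<forall>\<^sub>F n in sequentially. c n \<ge> 1" using c by (simp add: filterlim_at_top)
    moreover have "\<forall>\<^sub>F n in sequentially. n \<ge> (1::nat)" by (rule eventually_ge_at_top)
    ultimately show ?thesis
    proof eventually_elim
      case (elim n)
      then have "ln (real n) < ln (c n)" by (simp add: field_simps)
      then have "real n < c n" using elim by simp
      then show ?case using elim by simp
    qed
  qed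
  note upper = AE_trap_fraction_le[OF assms(1,5) this]
  \<comment> \<open>Here \<open>\<epsilon> \<le> 1\<close> enters: it puts \<beta> below the value
    \<open>sqrt (2 * ln 2)\<close> at which traps of level \<open>exp (\<beta>\<^sup>2 * n)\<close>
    cease to be abundant.\<close>
  have "\<beta>\<^sup>2 < (beta_c \<epsilon>)\<^sup>2" using assms by (intro power_strict_mono) auto
  also have "\<dots> = 2 * \<epsilon> * ln 2" using assms by (simp add: beta_c_def)
  also have "\<dots> \<le> 2 * 1 * ln 2" using assms by (intro mult_right_mono) auto
  finally have "\<beta>\<^sup>2 / 2 < ln 2" by simp
  note lower = AE_trap_fraction_ge[OF assms(1,5) this]
  \<comment> \<open>Both almost sure events concern the environment alone and not \<open>t\<close>
    or \<open>s\<close>, so a single null set serves all times.\<close>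
  from upper lower AE_space show ?thesis
  proof eventually_elim
    case (elim \<omega>)
    show ?case
      using correlation_tendsto_0[OF assms(2)[OF elim(3)] assms(5,6) _ _ c y elim(1,2)] by blast
  qed
qed

end
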